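(* Let $\hat{\Sigma}_x\in\mathbb{C}^{L\times L}$ be a Hermitian positive semidefinite matrix of rank $r$, and let $X=\hat{\Sigma}_x\odot\operatorname{Circulant}\{[1,e^{\imath\varphi_1},\ldots,e^{\imath\varphi_{L-1}}]\}$ for some angles $\varphi_1,\ldots,\varphi_{L-1}\in[0,2\pi)$. Suppose that $\hat{\Sigma}_x[i,j]\neq0$ for all $i,j$, and that either $r=1$, or $1<r<\sqrt{L}$ and the second-smallest singular value of the matrix $W$ (constructed from $X$ as described in the context) is strictly positive. If $\widetilde{\varphi}_1,\ldots,\widetilde{\varphi}_{L-1}\in[0,2\pi)$ are such that $\widetilde{X}:=X\odot\operatorname{Circulant}\{[1,e^{-\imath\widetilde{\varphi}_1},\ldots,e^{-\imath\widetilde{\varphi}_{L-1}}]\}$ is Hermitian and positive semidefinite, then $\widetilde{X}\in\Omega(\hat{\Sigma}_x)$.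
   Context: All indices are in $\{0,\ldots,L-1\}$ and are taken modulo $L$. $\overline{(\cdot)}$ is complex conjugation, $(\cdot)^*$ is conjugate transpose, $\odot$ is the entrywise product, $\otimes$ is the Kronecker product, $\operatorname{Circulant}\{z\}[k_1,k_2]=z[\operatorname{mod}(k_2-k_1,L)]$ for $z\in\mathbb{C}^L$, $f_\ell\in\mathbb{C}^L$ is given by $f_\ell[k]=e^{-\imath2\pi k\ell/L}$, and $\Omega(\hat{\Sigma}_x)=\{\operatorname{diag}(f_\ell)\,\hat{\Sigma}_x\,\operatorname{diag}(f_\ell^* ):\ \ell=0,\ldots,L-1\}$. Construction of $W$ (for $r<\sqrt{L}$) from $X$. Let $R_{i,j}\{X\}[k,m]=X[k-i,m-j]$ and $H_{i,j}=X\odot\overline{R_{i,j}\{X\}}$. The matrix $H_{i,i}$ equals $\hat{\Sigma}_x\odot\overline{R_{i,i}\{\hat{\Sigma}_x\}}$ and is Hermitian positive semidefinite of rank at most $r^2$; let $V^{(i)}\in\mathbb{C}^{L\times r^2}$ have as columns $r^2$ orthonormal eigenvectors of $H_{i,i}$ corresponding to its $r^2$ largest eigenvalues. With $\mathbf{e}_m$ the $m$-th standard basis vector and $\operatorname{vec}$ the column-stacking operation, set $Z^{(i)}=\overline{V^{(i+1)}}\otimes V^{(i)}\in\mathbb{C}^{L^2\times r^4}$ and $M^{(i)}_m=\operatorname{vec}\{H_{i,i+1}\}\odot\operatorname{vec}\{\operatorname{Circulant}\{\mathbf{e}_m\}\}\in\mathbb{C}^{L^2}$. Then $W=[\,M\;\;-\operatorname{BlockDiag}\{Z^{(0)},\ldots,Z^{(L-1)}\}\,]\in\mathbb{C}^{L^3\times(L+r^4L)}$,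 where $M\in\mathbb{C}^{L^3\times L}$ has $M^{(i)}_m$ as its block in block row $i$ and column $m$. Singular values are counted with multiplicity. *)

theory Defs
  imports
    Complex_Main
    "HOL-Library.Multiset"
    "HOL-Computational_Algebra.Polynomial"
    "Jordan_Normal_Form.Matrix"
    "Jordan_Normal_Form.Char_Poly"
    "Jordan_Normal_Form.Schur_Decomposition"
    "Jordan_Normal_Form.DL_Rank"
begin

definition hermitian :: "complex mat \<Rightarrow> bool" where
  "hermitian A \<longleftrightarrow> square_mat A \<and> mat_adjoint A = A"

text \<open>The order on complex numbers is the one with \<open>0 \<le> z\<close> iff \<open>z\<close> is real and
  nonnegative; \<open>(A *\<^sub>v v) \<bullet>c v\<close> is the quadratic form \<open>v\<^sup>* A v\<close>.\<close>

definition hermitian_psd :: "complex mat \<Rightarrow> bool" where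
  "hermitian_psd A \<longleftrightarrow>
     hermitian A \<and> (\<forall>v \<in> carrier_vec (dim_row A). 0 \<le> (A *\<^sub>v v) \<bullet>c v)"

definition hadamard :: "'a::times mat \<Rightarrow> 'a mat \<Rightarrow> 'a mat"  (infixl "\<odot>" 70) where
  "A \<odot> B = mat (dim_row A) (dim_col A) (\<lambda>(i, j). A $$ (i, j) * B $$ (i, j))"

definition hadamard_vec :: "'a::times vec \<Rightarrow> 'a vec \<Rightarrow> 'a vec"  (infixl "\<odot>\<^sub>v" 70) where
  "u \<odot>\<^sub>v v = vec (dim_vec u) (\<lambda>i. u $ i * v $ i)"

definition kronecker :: "'a::times mat \<Rightarrow> 'a mat \<Rightarrow> 'a mat"  (infixl "\<otimes>\<^sub>K" 70) where
  "A \<otimes>\<^sub>K B = mat (dim_row A * dim_row B) (dim_col A * dim_col B)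
     (\<lambda>(i, j). A $$ (i div dim_row B, j div dim_col B) * B $$ (i mod dim_row B, j mod dim_col B))"

definition mat_cnj :: "complex mat \<Rightarrow> complex mat" where
  "mat_cnj A = map_mat cnj A"

text \<open>Column stacking.\<close>

definition vectorize :: "'a mat \<Rightarrow> 'a vec" where
  "vectorize A = vec (dim_row A * dim_col A) (\<lambda>k. A $$ (k mod dim_row A, k div dim_row A))"

text \<open>\<open>sub_mod L a b\<close> is the representative in \<open>{0..<L}\<close> of \<open>a - b\<close> modulo \<open>L\<close>; the subtraction
  takes place in the integers.\<close>

definition sub_mod :: "nat \<Rightarrow> nat \<Rightarrow> nat \<Rightarrow> nat" where
  "sub_mod L a b = nat ((int a - int b) mod int L)"

definition circulant :: "'a vec \<Rightarrow> 'a mat" where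
  "circulant z = mat (dim_vec z) (dim_vec z) (\<lambda>(k1, k2). z $ sub_mod (dim_vec z) k2 k1)"

definition phase_vec :: "nat \<Rightarrow> (nat \<Rightarrow> real) \<Rightarrow> complex vec" where
  "phase_vec L \<phi> = vec L (\<lambda>m. if m = 0 then 1 else exp (\<i> * complex_of_real (\<phi> m)))"

definition fourier_vec :: "nat \<Rightarrow> nat \<Rightarrow> complex vec" where
  "fourier_vec L l = vec L (\<lambda>k. exp (- \<i> * 2 * complex_of_real pi * of_nat k * of_nat l / of_nat L))"

definition diag_of_vec :: "'a::zero vec \<Rightarrow> 'a mat" where
  "diag_of_vec v = mat_diag (dim_vec v) (\<lambda>k. v $ k)"

definition Omega :: "nat \<Rightarrow> complex mat \<Rightarrow> complex mat set" where
  "Omega L S =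
     {diag_of_vec (fourier_vec L l) * S * diag_of_vec (conjugate (fourier_vec L l)) | l. l < L}"

text \<open>An \<open>m \<times> n\<close> matrix has \<open>min m n\<close> singular values, counted with multiplicity: the square
  roots of the eigenvalues of the smaller of its two Gram matrices.\<close>

definition singular_values :: "complex mat \<Rightarrow> real multiset" where
  "singular_values A =
     image_mset (\<lambda>x. sqrt (Re x))
       (proots (char_poly (if dim_col A \<le> dim_row A then mat_adjoint A * A else A * mat_adjoint A)))"

definition second_smallest_singular_value :: "complex mat \<Rightarrow> real" where
  "second_smallest_singular_value A = sorted_list_of_multiset (singular_values A) ! 1"

text \<open>Eigenvalues of a Hermitian matrix (hence real) with multiplicity, in decreasing order.\<close>

definition eigenvalues_desc :: "complex mat \<Rightarrow> real list" where
  "eigenvalues_desc A = rev (sorted_list_of_multiset (image_mset Re (proots (char_poly A))))"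

text \<open>The columns of \<open>V\<close> are orthonormal eigenvectors of the Hermitian matrix \<open>A\<close> for its \<open>p\<close>
  largest eigenvalues (with multiplicity), in any order. Such a \<open>V\<close> is not unique.\<close>

definition leading_eigenvectors :: "complex mat \<Rightarrow> nat \<Rightarrow> complex mat \<Rightarrow> bool" where
  "leading_eigenvectors A p V \<longleftrightarrow>
     V \<in> carrier_mat (dim_row A) p \<and>
     (\<forall>i < p. \<forall>j < p. col V i \<bullet>c col V j = (if i = j then 1 else 0)) \<and>
     (\<exists>d :: nat \<Rightarrow> real.
        (\<forall>j < p. eigenvector A (col V j) (complex_of_real (d j))) \<and>
        image_mset d (mset_set {..<p}) = mset (take p (eigenvalues_desc A)))"

definition shift_mat :: "nat \<Rightarrow> nat \<Rightarrow> nat \<Rightarrow> complex mat \<Rightarrow> complex mat" where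
  "shift_mat L i j X = mat L L (\<lambda>(k, m). X $$ (sub_mod L k i, sub_mod L m j))"

definition H_mat :: "nat \<Rightarrow> complex mat \<Rightarrow> nat \<Rightarrow> nat \<Rightarrow> complex mat" where
  "H_mat L X i j = X \<odot> mat_cnj (shift_mat L i j X)"

definition Z_mat :: "nat \<Rightarrow> (nat \<Rightarrow> complex mat) \<Rightarrow> nat \<Rightarrow> complex mat" where
  "Z_mat L V i = mat_cnj (V ((i + 1) mod L)) \<otimes>\<^sub>K V i"

definition M_block :: "nat \<Rightarrow> complex mat \<Rightarrow> nat \<Rightarrow> nat \<Rightarrow> complex vec" where
  "M_block L X i m =
     vectorize (H_mat L X i ((i + 1) mod L)) \<odot>\<^sub>v vectorize (circulant (unit_vec L m))"

definition M_mat :: "nat \<Rightarrow> complex mat \<Rightarrow> complex mat" where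
  "M_mat L X = mat (L ^ 3) L (\<lambda>(k, m). M_block L X (k div L ^ 2) m $ (k mod L ^ 2))"

text \<open>Horizontal concatenation, as a block matrix whose lower blocks have no rows.\<close>

definition W_mat :: "nat \<Rightarrow> complex mat \<Rightarrow> (nat \<Rightarrow> complex mat) \<Rightarrow> complex mat" where
  "W_mat L X V =
     (let D = diag_block_mat (map (Z_mat L V) [0..<L])
      in four_block_mat (M_mat L X) (- D) (0\<^sub>m 0 L) (0\<^sub>m 0 (dim_col D)))"

lemma W_mat_carrier:
  assumes "\<And>i. i < L \<Longrightarrow> V i \<in> carrier_mat L (r ^ 2)"
  shows "W_mat L X V \<in> carrier_mat (L ^ 3) (L + r ^ 4 * L)"
proof -
  have Z: "dim_row (Z_mat L V i) = L ^ 2" "dim_col (Z_mat L V i) = r ^ 4" if "i < L" for i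
  proof -
    have "V i \<in> carrier_mat L (r ^ 2)" "V ((i + 1) mod L) \<in> carrier_mat L (r ^ 2)"
      using assms that by auto
    then show "dim_row (Z_mat L V i) = L ^ 2" "dim_col (Z_mat L V i) = r ^ 4"
      by (auto simp: Z_mat_def kronecker_def mat_cnj_def power2_eq_square power4_eq_xxxx)
  qed
  have "map dim_col (map (Z_mat L V) [0..<L]) = map (\<lambda>_. r ^ 4) [0..<L]"
    using Z by simp
  then have "dim_col (diag_block_mat (map (Z_mat L V) [0..<L])) = r ^ 4 * L"
    by (simp only: dim_diag_block_mat) (simp add: sum_list_triv)
  then show ?thesis
    by (auto simp: W_mat_def Let_def M_mat_def)
qed

end

theory Submission
  imports Defs
begin

text \<open>
  Write \<open>X' = \<Sigma> \<odot> circulant u\<close> with \<open>u\<close> unimodular and \<open>u\<^sub>0 = 1\<close>. The claim is that \<open>u\<close> is a character of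
  the cyclic group of order \<open>L\<close>, and for this it suffices that \<open>u\<^sub>m = c u\<^sub>m\<^sub>-\<^sub>1\<close> for one constant \<open>c\<close>.

  For \<open>r = 1\<close> the Schur complement of \<open>X'\<close> at its first diagonal entry has zero diagonal because
  \<open>X'\<close> and \<open>\<Sigma>\<close> have entries of equal modulus; being positive semidefinite it vanishes, so \<open>X'\<close> has
  rank one as well, and comparing it with \<open>\<Sigma>\<close> entrywise gives the recursion.

  For \<open>r > 1\<close> let \<open>Y = X \<odot> circulant w\<close> be positive semidefinite, \<open>w\<close> unimodular. A Gram
  representation of \<open>Y\<close> yields matrices \<open>B\<^sub>i\<close> with \<open>H\<^sub>i\<^sub>,\<^sub>j(Y) = B\<^sub>i B\<^sub>j\<^sup>*\<close>, and \<open>H\<^sub>i\<^sub>,\<^sub>i(Y) = H\<^sub>i\<^sub>,\<^sub>i(X)\<close>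
  has rank at most \<open>r\<^sup>2\<close>, so its leading eigenvectors \<open>V\<^sub>i\<close> span the range of \<open>B\<^sub>i\<close>. Hence
  \<open>H\<^sub>i\<^sub>,\<^sub>i\<^sub>+\<^sub>1(Y) = V\<^sub>i T\<^sub>i V\<^sub>i\<^sub>+\<^sub>1\<^sup>*\<close>, which says that \<open>z\<^sub>m = w\<^sub>m cnj w\<^sub>m\<^sub>-\<^sub>1\<close> extends to a vector in the kernel of
  \<open>W\<close>. Both \<open>\<Sigma>\<close> and \<open>X'\<close> are such \<open>Y\<close>; as the kernel of \<open>W\<close> is at most one-dimensional, the two
  vectors \<open>z\<close> are proportional, and the factor is \<open>c\<close>.
\<close>

section \<open>Characteristic polynomials and rank\<close>

lemma mat_adjoint_carrier [simp]:
  "A \<in> carrier_mat n m \<Longrightarrow> mat_adjoint A \<in> carrier_mat m n"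
  by (auto simp: mat_adjoint_def)

lemma dim_mat_adjoint [simp]:
  "dim_row (mat_adjoint A) = dim_col A" "dim_col (mat_adjoint A) = dim_row A"
  by (auto simp: mat_adjoint_def)

lemma index_mat_adjoint [simp]:
  fixes A :: "complex mat"
  shows "i < dim_col A \<Longrightarrow> j < dim_row A \<Longrightarrow> mat_adjoint A $$ (i, j) = cnj (A $$ (j, i))"
  by (simp add: mat_adjoint_def mat_of_rows_def)

lemma mat_adjoint_mult:
  fixes A B :: "complex mat"
  assumes "A \<in> carrier_mat n m" "B \<in> carrier_mat m l"
  shows "mat_adjoint (A * B) = mat_adjoint B * mat_adjoint A"
  using assms by (intro eq_matI) (auto simp: scalar_prod_def mult.commute intro!: sum.cong)

lemma mat_adjoint_adjoint [simp]:
  fixes A :: "complex mat"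
  shows "mat_adjoint (mat_adjoint A) = A"
  by (intro eq_matI) auto

lemma trace_mult_commute:
  fixes A B :: "'a::comm_semiring_0 mat"
  assumes "A \<in> carrier_mat n m" "B \<in> carrier_mat m n"
  shows "(\<Sum>i<n. (A * B) $$ (i, i)) = (\<Sum>j<m. (B * A) $$ (j, j))"
proof -
  have "(\<Sum>i<n. (A * B) $$ (i, i)) = (\<Sum>i<n. \<Sum>j<m. A $$ (i, j) * B $$ (j, i))"
    using assms by (intro sum.cong) (auto simp: scalar_prod_def atLeast0LessThan)
  also have "\<dots> = (\<Sum>j<m. \<Sum>i<n. B $$ (j, i) * A $$ (i, j))"
    by (subst sum.swap) (simp add: mult.commute)
  also have "\<dots> = (\<Sum>j<m. (B * A) $$ (j, j))"
    using assms by (intro sum.cong) (auto simp: scalar_prod_def atLeast0LessThan)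
  finally show ?thesis .
qed

text \<open>The trace is invariant under similarity, and a Schur form carries the eigenvalues, with
  multiplicity, on its diagonal.\<close>

lemma trace_eq_sum_proots:
  fixes A :: "complex mat"
  assumes A: "A \<in> carrier_mat n n"
  shows "(\<Sum>i<n. A $$ (i, i)) = sum_mset (proots (char_poly A))"
proof -
  obtain es where es: "char_poly A = (\<Prod>a\<leftarrow>es. [:- a, 1:])" "length es = n"
    using char_poly_factorized[OF A] by auto
  obtain B P Q where "schur_decomposition A es = (B, P, Q)"
    by (metis prod_cases3)
  with schur_decomposition[OF A es(1)]
  have sim: "similar_mat_wit A B P Q" and diag: "diag_mat B = es" by auto
  note w = similar_mat_witD2[OF A sim]
  have "(\<Sum>i<n. A $$ (i, i)) = (\<Sum>i<n. (P * (B * Q)) $$ (i, i))"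
    using w by (simp add: assoc_mult_mat[of _ n n _ n _ n])
  also have "\<dots> = (\<Sum>i<n. (B * Q * P) $$ (i, i))"
    by (rule trace_mult_commute) (use w in auto)
  also have "B * Q * P = B"
    using w by (simp add: assoc_mult_mat[of _ n n _ n _ n])
  also have "(\<Sum>i<n. B $$ (i, i)) = sum_list es"
    unfolding diag[symmetric] using w
    by (simp add: diag_mat_def sum_list_sum_nth atLeast0LessThan)
  also have "\<dots> = sum_mset (proots (char_poly A))"
  proof -
    have "proots (\<Prod>a\<leftarrow>xs. [:- a, 1:]) = mset xs" for xs :: "complex list"
    proof (induction xs)
      case (Cons a xs)
      have "(\<Prod>a\<leftarrow>xs. [:- a, 1:]) \<noteq> 0" by (auto simp: prod_list_zero_iff)
      then have "proots ([:- a, 1:] * (\<Prod>a\<leftarrow>xs. [:- a, 1:])) = {#a#} + mset xs"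
        using Cons by (subst proots_mult) auto
      then show ?case by simp
    qed simp
    then show ?thesis by (simp add: es sum_mset_sum_list)
  qed
  finally show ?thesis .
qed

section \<open>Algebraic multiplicity of the eigenvalue zero\<close>

text \<open>Two eliminations of one bordered matrix give
  \<open>x^p det(x I - A B) = x^n det(x I - B A)\<close>, a polynomial form of Sylvester's
  determinant identity. Keeping only the divisibility leaves the second determinant
  unevaluated.\<close>

lemma x_power_dvd_char_poly_mult:
  fixes A B :: "'a::field mat"
  assumes A: "A \<in> carrier_mat n p" and B: "B \<in> carrier_mat p n"
  shows "[:0, 1:] ^ n dvd [:0, 1:] ^ p * char_poly (A * B)"
proof -
  define x where "x = ([:0, 1:] :: 'a poly)"
  define A' where "A' = map_mat (\<lambda>a. [:a:]) A"
  define B' where "B' = map_mat (\<lambda>a. [:a:]) B"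
  have c [simp]: "A' \<in> carrier_mat n p" "B' \<in> carrier_mat p n"
    using A B by (auto simp: A'_def B'_def)
  \<comment> \<open>\<open>N1\<close> eliminates the lower left block of \<open>M\<close> from the right, \<open>N2\<close> from the left.\<close>
  define M where "M = four_block_mat (x \<cdot>\<^sub>m 1\<^sub>m n) A' B' (1\<^sub>m p)"
  define N1 where "N1 = four_block_mat (1\<^sub>m n) (0\<^sub>m n p) (- B') (1\<^sub>m p)"
  define N2 where "N2 = four_block_mat (1\<^sub>m n) (0\<^sub>m n p) (- B') (x \<cdot>\<^sub>m 1\<^sub>m p)"
  have cc: "M \<in> carrier_mat (n + p) (n + p)" "N1 \<in> carrier_mat (n + p) (n + p)"
    "N2 \<in> carrier_mat (n + p) (n + p)"
    by (auto simp: M_def N1_def N2_def)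
  have cp: "char_poly_matrix (A * B) = x \<cdot>\<^sub>m 1\<^sub>m n + A' * (- B')"
  proof -
    have "map_mat (\<lambda>a. [:- a:]) (A * B) = - map_mat (\<lambda>a. [:a:]) (A * B)"
      by (intro eq_matI) auto
    also have "\<dots> = A' * (- B')"
      unfolding map_poly_mult(1)[OF A B] A'_def[symmetric] B'_def[symmetric]
      using c(1)[THEN carrier_matD(2)] c(2)[THEN carrier_matD(1)] by simp
    finally show ?thesis
      using A by (simp add: char_poly_matrix_def x_def)
  qed
  have B'0: "B' + - B' = 0\<^sub>m p n" "- B' + B' = 0\<^sub>m p n"
    using c(2)[THEN carrier_matD(1)] c(2)[THEN carrier_matD(2)] by (auto intro!: eq_matI)
  have r: "x \<cdot>\<^sub>m 1\<^sub>m n * 1\<^sub>m n = x \<cdot>\<^sub>m 1\<^sub>m n" "x \<cdot>\<^sub>m 1\<^sub>m n * 0\<^sub>m n p = 0\<^sub>m n p"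
    "A' * 1\<^sub>m p = A'" "0\<^sub>m n p + A' = A'" "B' * 1\<^sub>m n = B'" "1\<^sub>m p * - B' = - B'"
    "B' * 0\<^sub>m n p = 0\<^sub>m p p" "1\<^sub>m p * 1\<^sub>m p = (1\<^sub>m p :: 'a poly mat)"
    "0\<^sub>m p p + 1\<^sub>m p = (1\<^sub>m p :: 'a poly mat)"
    "1\<^sub>m n * (x \<cdot>\<^sub>m 1\<^sub>m n) = x \<cdot>\<^sub>m 1\<^sub>m n" "0\<^sub>m n p * B' = 0\<^sub>m n n"
    "x \<cdot>\<^sub>m 1\<^sub>m n + 0\<^sub>m n n = x \<cdot>\<^sub>m 1\<^sub>m n" "1\<^sub>m n * A' = A'"
    "0\<^sub>m n p * 1\<^sub>m p = (0\<^sub>m n p :: 'a poly mat)" "A' + 0\<^sub>m n p = A'"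
    "x \<cdot>\<^sub>m 1\<^sub>m p * 1\<^sub>m p = x \<cdot>\<^sub>m 1\<^sub>m p"
    by (auto intro!: right_mult_one_mat left_mult_one_mat left_add_zero_mat right_add_zero_mat
        right_mult_zero_mat[OF c(2)] left_mult_zero_mat[OF c(2)] right_mult_one_mat[OF c(2)]
        right_mult_one_mat[OF c(1)] left_mult_one_mat[OF c(1)] c(2))
  have "- B' * (x \<cdot>\<^sub>m 1\<^sub>m n) = - (x \<cdot>\<^sub>m B')" "x \<cdot>\<^sub>m 1\<^sub>m p * B' = x \<cdot>\<^sub>m B'"
    using mult_smult_distrib[OF c(2), of "1\<^sub>m n" n x] mult_smult_assoc_mat[OF _ c(2), of "1\<^sub>m p" p x]
      right_mult_one_mat[OF c(2)] left_mult_one_mat[OF c(2)] uminus_mult_left_mat[of B' "x \<cdot>\<^sub>m 1\<^sub>m n"]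
      c(2)[THEN carrier_matD(2)] by auto
  note xB0 = this
  have xB: "- B' * (x \<cdot>\<^sub>m 1\<^sub>m n) + x \<cdot>\<^sub>m 1\<^sub>m p * B' = 0\<^sub>m p n"
    unfolding xB0 by (rule uminus_l_inv_mat) (use c in auto)
  have e1: "x \<cdot>\<^sub>m 1\<^sub>m n * 1\<^sub>m n + A' * (- B') = x \<cdot>\<^sub>m 1\<^sub>m n + A' * (- B')"
    "x \<cdot>\<^sub>m 1\<^sub>m n * 0\<^sub>m n p + A' * 1\<^sub>m p = A'"
    "B' * 1\<^sub>m n + 1\<^sub>m p * (- B') = 0\<^sub>m p n"
    "B' * 0\<^sub>m n p + 1\<^sub>m p * 1\<^sub>m p = 1\<^sub>m p"
    by (simp_all only: r B'0)
  have e2: "1\<^sub>m n * (x \<cdot>\<^sub>m 1\<^sub>m n) + 0\<^sub>m n p * B' = x \<cdot>\<^sub>m 1\<^sub>m n"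
    "1\<^sub>m n * A' + 0\<^sub>m n p * 1\<^sub>m p = A'"
    "- B' * (x \<cdot>\<^sub>m 1\<^sub>m n) + x \<cdot>\<^sub>m 1\<^sub>m p * B' = 0\<^sub>m p n"
    "- B' * A' + x \<cdot>\<^sub>m 1\<^sub>m p * 1\<^sub>m p = - B' * A' + x \<cdot>\<^sub>m 1\<^sub>m p"
    by (simp_all only: r xB)
  have sumC: "x \<cdot>\<^sub>m 1\<^sub>m n + A' * (- B') \<in> carrier_mat n n"
    by (intro add_carrier_mat mult_carrier_mat[of _ _ p]) (use c in auto)
  have "M * N1 = four_block_mat (x \<cdot>\<^sub>m 1\<^sub>m n + A' * (- B')) A' (0\<^sub>m p n) (1\<^sub>m p)"
    unfolding M_def N1_def
    using e1 by (subst mult_four_block_mat[of _ n n _ p _ p _ _ n _ p]) auto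
  then have "det (M * N1) = char_poly (A * B)"
    using c sumC by (simp only: char_poly_def cp)
      (subst det_four_block_mat_lower_left_zero[of _ n _ p], auto)
  moreover have "det N1 = 1"
    unfolding N1_def by (subst det_four_block_mat_upper_right_zero[of _ n _ p]) auto
  ultimately have M: "det M = char_poly (A * B)"
    using det_mult[OF cc(1,2)] by simp
  have "N2 * M = four_block_mat (x \<cdot>\<^sub>m 1\<^sub>m n) A' (0\<^sub>m p n) (- B' * A' + x \<cdot>\<^sub>m 1\<^sub>m p)"
    unfolding M_def N2_def
    using e2 by (subst mult_four_block_mat[of _ n n _ p _ p _ _ n _ p]) auto
  then have "det (N2 * M) = x ^ n * det (- B' * A' + x \<cdot>\<^sub>m 1\<^sub>m p)"
    using c by (simp only:) (subst det_four_block_mat_lower_left_zero[of _ n _ p], auto)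
  moreover have "det N2 = x ^ p"
    unfolding N2_def by (subst det_four_block_mat_upper_right_zero[of _ n _ p]) auto
  ultimately have "x ^ p * det M = x ^ n * det (- B' * A' + x \<cdot>\<^sub>m 1\<^sub>m p)"
    using det_mult[OF cc(3,1)] by simp
  then show ?thesis
    unfolding M x_def by (metis dvd_triv_left)
qed

lemma char_poly_neq_0: "A \<in> carrier_mat n n \<Longrightarrow> char_poly (A :: complex mat) \<noteq> 0"
  using degree_monic_char_poly[of A n] by auto

text \<open>Compare the powers of \<open>x\<close> in the preceding divisibility. This is how a
  factorization through dimension \<open>p\<close>, that is, a rank bound, becomes a count of zero
  eigenvalues.\<close>

lemma order_0_char_poly_mult:
  fixes A B :: "complex mat"
  assumes A: "A \<in> carrier_mat n p" and B: "B \<in> carrier_mat p n"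
  shows "n \<le> p + order 0 (char_poly (A * B))"
proof -
  have nz: "char_poly (A * B) \<noteq> 0" using A B by (intro char_poly_neq_0[of _ n]) auto
  then have "n \<le> order 0 ([:0, 1:] ^ p * char_poly (A * B))"
    using x_power_dvd_char_poly_mult[OF A B]
      order_divides[of "0::complex" n "[:0, 1:] ^ p * char_poly (A * B)"] by simp
  also have "\<dots> = p + order 0 (char_poly (A * B))"
    using nz order_power_n_n[of "0::complex" p] by (subst order_mult) auto
  finally show ?thesis .
qed

text \<open>The derivative of the characteristic polynomial is a sum over principal minors, each of which
  inherits a kernel vector as soon as the kernel is two-dimensional.\<close>

lemma eigenvalue_0_mat_delete:
  fixes A :: "complex mat"
  assumes A: "A \<in> carrier_mat n n" and w: "w \<in> carrier_vec n" "w \<noteq> 0\<^sub>v n" "A *\<^sub>v w = 0\<^sub>v n"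
    and i: "i < n" "w $ i = 0"
  shows "eigenvalue (mat_delete A i i) 0"
proof -
  obtain k where n: "n = Suc k" using i by (cases n) auto
  \<comment> \<open>The vector \<open>w\<close> without coordinate \<open>i\<close>. The dropped
    coordinate is zero, so the remaining equations of \<open>A w = 0\<close> are unchanged.\<close>
  define w' where "w' = vec k (\<lambda>j. w $ insert_index i j)"
  have img: "bij_betw (insert_index i) {0..<k} ({0..<n} - {i})"
    using insert_index_image[of i k] i insert_index_inj_on[of i] by (auto simp: bij_betw_def n)
  have "mat_delete A i i *\<^sub>v w' = 0\<^sub>v k"
  proof (rule eq_vecI)
    fix a assume "a < dim_vec (0\<^sub>v k :: complex vec)"
    then have a: "a < k" by simp
    then have ia: "insert_index i a < n" by (auto simp: n insert_index_def)
    have "(mat_delete A i i *\<^sub>v w') $ a =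
        (\<Sum>j\<in>{0..<k}. A $$ (insert_index i a, insert_index i j) * w $ insert_index i j)"
      using a A i mat_delete_index[of A k i i]
      by (auto simp: scalar_prod_def w'_def n intro!: sum.cong)
    also have "\<dots> = (\<Sum>j\<in>{0..<n} - {i}. A $$ (insert_index i a, j) * w $ j)"
      by (rule sum.reindex_bij_betw[OF img])
    also have "\<dots> = (\<Sum>j\<in>{0..<n}. A $$ (insert_index i a, j) * w $ j)"
      using i by (intro sum.mono_neutral_left) auto
    also have "\<dots> = (A *\<^sub>v w) $ insert_index i a"
      using A w(1) ia by (simp add: scalar_prod_def)
    finally show "(mat_delete A i i *\<^sub>v w') $ a = 0\<^sub>v k $ a"
      using w ia a by simp
  qed (use A n in auto)
  moreover have "w' \<noteq> 0\<^sub>v k"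
  proof
    assume 0: "w' = 0\<^sub>v k"
    have "w $ j = 0" if "j < n" for j
    proof (cases "j = i")
      case False
      then have "j \<in> insert_index i ` {0..<k}" using that img by (simp add: bij_betw_def)
      then obtain j' where "j' < k" "j = insert_index i j'" by auto
      then show ?thesis using arg_cong[OF 0, of "\<lambda>v. v $ j'"] by (simp add: w'_def)
    qed (use i in simp)
    then have "w = 0\<^sub>v n" using w(1) by (intro eq_vecI) auto
    with w show False by simp
  qed
  moreover have "dim_row (mat_delete A i i) = k" using A n by simp
  ultimately show ?thesis
    unfolding eigenvalue_def eigenvector_def
    by (intro exI[of _ w']) (auto simp: w'_def)
qed

lemma order_0_char_poly_ge_2:
  fixes A :: "complex mat"
  assumes A: "A \<in> carrier_mat n n"
    and v: "v1 \<in> carrier_vec n" "v2 \<in> carrier_vec n" "A *\<^sub>v v1 = 0\<^sub>v n" "A *\<^sub>v v2 = 0\<^sub>v n"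
    and indep: "\<And>a b. a \<cdot>\<^sub>v v1 + b \<cdot>\<^sub>v v2 = 0\<^sub>v n \<Longrightarrow> a = 0 \<and> b = 0"
  shows "2 \<le> order 0 (char_poly A)"
proof -
  have del: "eigenvalue (mat_delete A i i) 0" if i: "i < n" for i
  proof -
    \<comment> \<open>The combination is chosen to vanish at coordinate \<open>i\<close>, so that it
      survives deletion of row and column \<open>i\<close>.\<close>
    obtain a b where ab: "a \<noteq> 0 \<or> b \<noteq> 0" "a * v1 $ i + b * v2 $ i = 0"
    proof (cases "v1 $ i = 0")
      case True
      then show ?thesis using that[of 1 0] by simp
    next
      case False
      then show ?thesis using that[of "v2 $ i" "- v1 $ i"] by (simp add: mult.commute)
    qed
    show ?thesis
    proof (rule eigenvalue_0_mat_delete[OF A _ _ _ i])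
      show "a \<cdot>\<^sub>v v1 + b \<cdot>\<^sub>v v2 \<in> carrier_vec n" using v by auto
      show "a \<cdot>\<^sub>v v1 + b \<cdot>\<^sub>v v2 \<noteq> 0\<^sub>v n" using indep ab by blast
      show "A *\<^sub>v (a \<cdot>\<^sub>v v1 + b \<cdot>\<^sub>v v2) = 0\<^sub>v n"
        using v A by (simp add: mult_add_distrib_mat_vec[of _ n n] mult_mat_vec[of _ n n])
           (intro eq_vecI, auto)
      show "(a \<cdot>\<^sub>v v1 + b \<cdot>\<^sub>v v2) $ i = 0" using ab v i by simp
    qed
  qed
  have v1: "v1 \<noteq> 0\<^sub>v n"
  proof
    assume "v1 = 0\<^sub>v n"
    then have "1 \<cdot>\<^sub>v v1 + 0 \<cdot>\<^sub>v v2 = 0\<^sub>v n" using v by (intro eq_vecI) auto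
    from indep[OF this] show False by simp
  qed
  then have n: "n > 0" using v(1) by (intro gr0I) (auto intro: eq_vecI)
  let ?p = "char_poly A"
  have p0: "?p \<noteq> 0" and dp: "pderiv ?p \<noteq> 0"
    using char_poly_neq_0[OF A] degree_monic_char_poly[OF A] n by (auto simp: pderiv_eq_0_iff)
  have "eigenvalue A 0"
    unfolding eigenvalue_def eigenvector_def using v v1 A by (intro exI[of _ v1]) auto
  then have r0: "order 0 ?p \<noteq> 0"
    using eigenvalue_root_char_poly[OF A] p0 by (simp add: order_root)
  have "poly (pderiv ?p) 0 = (\<Sum>i<n. poly (char_poly (mat_delete A i i)) 0)"
    by (simp add: pderiv_char_poly[OF A] poly_sum)
  also have "\<dots> = 0"
  proof (intro sum.neutral ballI)
    fix i assume "i \<in> {..<n}"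
    moreover have "mat_delete A i i \<in> carrier_mat (n - 1) (n - 1)"
      using A by (auto simp: mat_delete_def)
    ultimately show "poly (char_poly (mat_delete A i i)) 0 = 0"
      using del eigenvalue_root_char_poly by blast
  qed
  finally have "order 0 (pderiv ?p) \<noteq> 0"
    using dp by (simp add: order_root)
  \<comment> \<open>Zero is a root of both the polynomial and its derivative, and differentiation
    lowers the order of a root by exactly one.\<close>
  moreover have "order 0 ?p = Suc (order 0 (pderiv ?p))"
    using order_pderiv[of ?p 0] p0 r0 by (simp add: order_root)
  ultimately show ?thesis by simp
qed

section \<open>Sorted lists of eigenvalues\<close>

text \<open>Were the second entry positive, so would be all later ones, and zero could occur only at
  the head.\<close>

lemma sorted_nth_1_le_0:
  fixes xs :: "real list"
  assumes "sorted xs" "2 \<le> count (mset xs) 0"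
  shows "xs ! 1 \<le> 0"
proof (rule ccontr)
  assume neg: "\<not> xs ! 1 \<le> 0"
  have "2 \<le> length xs" using assms(2) by (metis count_le_size le_trans size_mset)
  then obtain a b ys where xs: "xs = a # b # ys"
    by (metis One_nat_def Suc_1 Suc_le_length_iff)
  have "\<forall>y\<in>set (b # ys). 0 < y" using neg assms(1) by (auto simp: xs)
  then have "count (mset (b # ys)) 0 = 0" by (subst count_eq_zero_iff) auto
  with assms(2) show False by (auto simp: xs split: if_splits)
qed

text \<open>The length bound says that at most \<open>p\<close> entries are nonzero. In a decreasing
  nonnegative list these come first, so everything after position \<open>p\<close> is zero.\<close>

lemma sum_list_take_sorted_desc:
  fixes xs :: "real list"
  assumes "sorted (rev xs)" "\<forall>x\<in>set xs. 0 \<le> x" "length xs \<le> p + count (mset xs) 0"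
  shows "sum_list (take p xs) = sum_list xs"
proof -
  have "set (drop p xs) \<subseteq> {0}"
  proof (rule ccontr)
    assume "\<not> set (drop p xs) \<subseteq> {0}"
    then obtain y where y: "y \<in> set (drop p xs)" "y \<noteq> 0" by auto
    then have y0: "0 < y" using assms(2) by (metis in_set_dropD order_le_less)
    have "sorted (rev (take p xs @ drop p xs))" using assms(1) by simp
    then have "\<forall>x\<in>set (take p xs). y \<le> x" using y unfolding rev_append sorted_append by auto
    then have "count (mset (take p xs)) 0 = 0" using y0 by (subst count_eq_zero_iff) auto
    moreover have "count (mset (drop p xs)) 0 < size (mset (drop p xs))"
    proof -
      obtain M where "mset (drop p xs) = add_mset y M"
        using y(1) multi_member_split[of y "mset (drop p xs)"] by auto
      then show ?thesis using y(2) count_le_size[of M 0] by simp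
    qed
    moreover have "count (mset xs) 0 = count (mset (take p xs)) 0 + count (mset (drop p xs)) 0"
      by (metis append_take_drop_id count_union mset_append)
    moreover have "p < length xs" using y(1) by (intro not_le_imp_less notI) simp
    moreover have "size (mset (drop p xs)) = length xs - p" by simp
    ultimately show False using assms(3) by linarith
  qed
  then have "sum_list (drop p xs) = 0" by (intro sum_list_neutral) auto
  then show ?thesis by (metis add.right_neutral append_take_drop_id sum_list_append)
qed

section \<open>Rank as a factorization\<close>

text \<open>The columns of \<open>P\<close> form a maximal independent set of columns of
  \<open>A\<close>; \<open>Q\<close> holds the coefficients of all columns with respect to
  them.\<close>

lemma rank_factorization:
  fixes A :: "'a::field mat"
  assumes A: "A \<in> carrier_mat n m"
  shows "\<exists>P Q. P \<in> carrier_mat n (vec_space.rank n A) \<and> Q \<in> carrier_mat (vec_space.rank n A) m \<and>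
    A = P * Q"
proof -
  interpret vec_space "TYPE('a)" n .
  have cols: "set (cols A) \<subseteq> carrier_vec n" using cols_dim A by blast
  obtain S where S: "finite S" "maximal S (\<lambda>T. T \<subseteq> set (cols A) \<and> lin_indpt T)"
  proof -
    have "\<exists>S. finite S \<and> maximal S (\<lambda>T. T \<subseteq> set (cols A) \<and> lin_indpt T) \<and> {} \<subseteq> S"
      by (rule maximal_exists_superset[of "set (cols A)"])
         (auto simp: lin_dep_def)
    then show ?thesis using that by blast
  qed
  have rank: "rank A = card S" by (rule rank_card_indpt[OF A S(2)])
  have SA: "S \<subseteq> set (cols A)" "lin_indpt S" using S(2) by (auto simp: maximal_def)
  have span: "v \<in> span S" if v: "v \<in> set (cols A)" for v
  proof (rule ccontr)
    assume nv: "v \<notin> span S"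
    have SC: "S \<subseteq> carrier_vec n" and vC: "v \<in> carrier_vec n" using SA(1) cols v by auto
    have vS: "v \<notin> S" using nv span_mem[OF SC] by auto
    moreover have "lin_indpt (S \<union> {v})"
      using lin_dep_iff_in_span[OF SC SA(2) vC vS] nv by simp
    ultimately show False using S(2) SA v by (auto simp: maximal_def)
  qed
  obtain bs where bs: "set bs = S" "distinct bs" using finite_distinct_list[OF S(1)] by blast
  have len: "length bs = rank A" using distinct_card[OF bs(2)] bs(1) rank by simp
  define P where "P = mat_of_cols n bs"
  have P: "P \<in> carrier_mat n (rank A)" using len by (auto simp: P_def)
  have cP: "cols P = bs" using bs SA cols by (simp add: P_def cols_mat_of_cols)
  have "\<exists>q. q \<in> carrier_vec (rank A) \<and> P *\<^sub>v q = col A j" if j: "j < m" for j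
  proof -
    have "col A j \<in> span S" using span j A by (simp add: cols_def)
    then obtain a where "col A j = lincomb a S"
      using finite_span[OF S(1)] SA cols by auto
    then have "P *\<^sub>v vec (rank A) (\<lambda>i. a (col P i)) = col A j"
      using mat_mult_eq_lincomb[OF P, of a] cP bs by simp
    then show ?thesis by (intro exI[of _ "vec (rank A) (\<lambda>i. a (col P i))"]) simp
  qed
  then obtain q where q: "\<And>j. j < m \<Longrightarrow> q j \<in> carrier_vec (rank A)" "\<And>j. j < m \<Longrightarrow> P *\<^sub>v q j = col A j"
    by metis
  define Q where "Q = mat (rank A) m (\<lambda>(i, j). q j $ i)"
  have "A = P * Q"
  proof (rule eq_matI)
    fix i j assume "i < dim_row (P * Q)" "j < dim_col (P * Q)"
    then have ij: "i < n" "j < m" using P by (auto simp: Q_def)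
    have "col Q j = q j" using q(1)[OF ij(2)] ij by (auto simp: Q_def)
    then have "(P * Q) $$ (i, j) = (P *\<^sub>v q j) $ i" using P ij by (simp add: Q_def)
    then show "A $$ (i, j) = (P * Q) $$ (i, j)" using q(2) ij A by simp
  qed (use P A in \<open>auto simp: Q_def\<close>)
  then show ?thesis using P by (intro exI[of _ P] exI[of _ Q]) (auto simp: Q_def)
qed

section \<open>Positive semidefinite kernels\<close>

text \<open>Working with functions and a size bound lets an induction pass to a leading principal
  block by lowering the bound alone.\<close>

definition psd_kernel :: "nat \<Rightarrow> (nat \<Rightarrow> nat \<Rightarrow> complex) \<Rightarrow> bool" where
  "psd_kernel n F \<longleftrightarrow> (\<forall>i<n. \<forall>j<n. F j i = cnj (F i j)) \<and>
     (\<forall>c. 0 \<le> (\<Sum>i<n. \<Sum>j<n. cnj (c i) * F i j * c j))"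

lemma psd_kernel_sym: "psd_kernel n F \<Longrightarrow> i < n \<Longrightarrow> j < n \<Longrightarrow> F j i = cnj (F i j)"
  unfolding psd_kernel_def by blast

lemma psd_kernel_nonneg:
  "psd_kernel n F \<Longrightarrow> 0 \<le> (\<Sum>i<n. \<Sum>j<n. cnj (c i) * F i j * c j)"
  unfolding psd_kernel_def by blast

text \<open>On vectors \<open>e_i + t e_p\<close> the quadratic term in \<open>t\<close> is absent,
  so a nonzero \<open>F i p\<close> would let the form become negative.\<close>

lemma psd_kernel_zero_diag:
  assumes F: "psd_kernel n F" and p: "p < n" "F p p = 0" and i: "i < n"
  shows "F i p = 0"
proof (rule ccontr)
  assume nz: "F i p \<noteq> 0"
  then have ip: "i \<noteq> p" using p by auto
  \<comment> \<open>The scale is chosen so that the form takes real part \<open>-1\<close> at the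
    test vector.\<close>
  define s where "s = (Re (F i i) + 1) / (2 * (cmod (F i p))\<^sup>2)"
  define t where "t = - complex_of_real s * cnj (F i p)"
  define c where "c = (\<lambda>k. if k = i then 1 else if k = p then t else 0)"
  have sum2: "(\<Sum>k<n. g k) = g i + g p" if "\<And>k. k \<noteq> i \<Longrightarrow> k \<noteq> p \<Longrightarrow> g k = 0" for g :: "nat \<Rightarrow> complex"
  proof -
    have "(\<Sum>k<n. g k) = (\<Sum>k\<in>{i, p}. g k)"
      using that i p by (intro sum.mono_neutral_right) auto
    then show ?thesis using ip by simp
  qed
  have cs: "c i = 1" "c p = t" using ip by (auto simp: c_def)
  have herm: "F p i = cnj (F i p)" by (rule psd_kernel_sym[OF F i p(1)])
  have "(\<Sum>a<n. \<Sum>b<n. cnj (c a) * F a b * c b) = (\<Sum>a<n. cnj (c a) * F a i + cnj (c a) * F a p * t)"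
    by (intro sum.cong refl) (subst sum2, auto simp: c_def ip ip[symmetric])
  also have "\<dots> = F i i + F i p * t + cnj t * F p i"
    using p by (subst sum2) (auto simp: c_def ip ip[symmetric])
  also have "\<dots> = F i i + 2 * F i p * t"
    by (simp add: herm t_def)
  finally have Q: "(\<Sum>a<n. \<Sum>b<n. cnj (c a) * F a b * c b) = F i i + 2 * F i p * t" .
  have "F i p * t = - complex_of_real (s * (cmod (F i p))\<^sup>2)"
    unfolding t_def of_real_mult complex_norm_square by (simp add: mult_ac)
  also have "s * (cmod (F i p))\<^sup>2 = (Re (F i i) + 1) / 2"
    using nz by (simp add: s_def)
  finally have "F i p * t = complex_of_real (- ((Re (F i i) + 1) / 2))" by simp
  then have "Re (F i p * t) = - ((Re (F i i) + 1) / 2)" by (simp only: Re_complex_of_real)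
  moreover have "Re (F i i + 2 * F i p * t) = Re (F i i) + 2 * Re (F i p * t)"
    by (simp add: algebra_simps)
  ultimately have "Re (F i i + 2 * F i p * t) = - 1" by argo
  moreover have "0 \<le> F i i + 2 * F i p * t"
    unfolding Q[symmetric] by (rule psd_kernel_nonneg[OF F])
  ultimately show False by (simp add: less_eq_complex_def)
qed

lemma psd_kernel_restrict:
  assumes F: "psd_kernel (Suc n) F"
  shows "psd_kernel n F"
  unfolding psd_kernel_def
proof (intro conjI allI impI)
  fix c
  have "0 \<le> (\<Sum>i<Suc n. \<Sum>j<Suc n. cnj ((c(n := 0)) i) * F i j * (c(n := 0)) j)"
    by (rule psd_kernel_nonneg[OF F])
  then show "0 \<le> (\<Sum>i<n. \<Sum>j<n. cnj (c i) * F i j * c j)" by simp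
qed (rule psd_kernel_sym[OF F], auto)

text \<open>Completing the square: the complement at \<open>c\<close> equals the original form at a
  vector \<open>d\<close> that differs from \<open>c\<close> only in coordinate \<open>p\<close>.
  With a zero pivot, division by zero yields zero and the complement is \<open>F\<close>
  itself.\<close>

lemma psd_kernel_schur_complement:
  assumes F: "psd_kernel n F" and p: "p < n"
  shows "psd_kernel n (\<lambda>i j. F i j - F i p * F p j / F p p)"
proof (cases "F p p = 0")
  case False
  have herm: "F j i = cnj (F i j)" if "i < n" "j < n" for i j
    by (rule psd_kernel_sym[OF F that])
  have real: "cnj (F p p) = F p p" using herm[OF p p] by (rule sym)
  show ?thesis
    unfolding psd_kernel_def
  proof (intro conjI allI impI)
    fix i j assume "i < n" "j < n"
    then show "F j i - F j p * F p i / F p p = cnj (F i j - F i p * F p j / F p p)"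
      using herm[of i j] herm[of i p] herm[of p j] p real by (simp add: mult.commute)
  next
    fix c :: "nat \<Rightarrow> complex"
    define s where "s = (\<Sum>j<n. F p j * c j)"
    \<comment> \<open>The shift makes row \<open>p\<close> of \<open>F d\<close> vanish. Hence the
      left factor \<open>d\<close> can later be replaced by \<open>c\<close>: the two differ only
      where the right factor is zero.\<close>
    define d where "d = (\<lambda>j. c j - (if j = p then s / F p p else 0))"
    have s': "(\<Sum>i<n. cnj (c i) * F i p) = cnj s"
      unfolding s_def cnj_sum
    proof (intro sum.cong refl)
      fix i assume "i \<in> {..<n}"
      then show "cnj (c i) * F i p = cnj (F p i * c i)" using herm[of p i] p by simp
    qed
    have row: "(\<Sum>j<n. F i j * d j) = (\<Sum>j<n. F i j * c j) - F i p * s / F p p" if "i < n" for i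
    proof -
      have "(\<Sum>j<n. F i j * d j) = (\<Sum>j<n. F i j * c j - (if j = p then F i p * s / F p p else 0))"
        by (intro sum.cong) (auto simp: d_def algebra_simps)
      then show ?thesis using p by (simp add: sum_subtractf)
    qed
    have "0 \<le> (\<Sum>i<n. \<Sum>j<n. cnj (d i) * F i j * d j)"
      by (rule psd_kernel_nonneg[OF F])
    also have "\<dots> = (\<Sum>i<n. cnj (d i) * (\<Sum>j<n. F i j * d j))"
      by (simp add: sum_distrib_left mult.assoc)
    also have "\<dots> = (\<Sum>i<n. cnj (d i) * ((\<Sum>j<n. F i j * c j) - F i p * s / F p p))"
      by (intro sum.cong) (auto simp: row)
    also have "\<dots> = (\<Sum>i<n. cnj (c i) * ((\<Sum>j<n. F i j * c j) - F i p * s / F p p))"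
    proof (intro sum.cong refl)
      fix i
      show "cnj (d i) * ((\<Sum>j<n. F i j * c j) - F i p * s / F p p) =
          cnj (c i) * ((\<Sum>j<n. F i j * c j) - F i p * s / F p p)"
        using False by (cases "i = p") (auto simp: d_def s_def)
    qed
    also have "\<dots> = (\<Sum>i<n. \<Sum>j<n. cnj (c i) * (F i j - F i p * F p j / F p p) * c j)"
    proof (intro sum.cong refl)
      fix i
      have "F i p * s / F p p = (\<Sum>j<n. F i p * F p j / F p p * c j)"
        by (simp add: s_def sum_distrib_left sum_divide_distrib mult_ac)
      then show "cnj (c i) * ((\<Sum>j<n. F i j * c j) - F i p * s / F p p) =
          (\<Sum>j<n. cnj (c i) * (F i j - F i p * F p j / F p p) * c j)"
        by (simp add: sum_subtractf[symmetric] sum_distrib_left algebra_simps)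
    qed
    finally show "0 \<le> (\<Sum>i<n. \<Sum>j<n. cnj (c i) * (F i j - F i p * F p j / F p p) * c j)" .
  qed
qed (use F in simp)

lemma psd_kernel_diag:
  assumes F: "psd_kernel n F" and i: "i < n"
  shows "0 \<le> F i i"
proof -
  have "0 \<le> (\<Sum>a<n. \<Sum>b<n. cnj (if a = i then 1 else 0) * F a b * (if b = i then 1 else 0))"
    by (rule psd_kernel_nonneg[OF F])
  also have "\<dots> = (\<Sum>a<n. (if a = i then 1 else 0) * F a i)"
    using i by (intro sum.cong refl) (simp add: if_distrib cong: if_cong)
  also have "\<dots> = F i i"
    using i by (simp add: if_distrib[of "\<lambda>x. x * _"] cong: if_cong)
  finally show ?thesis .
qed

text \<open>Cholesky factorization: each step splits off the Schur complement at the last index. Division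
  by a zero pivot is harmless, since then its row and column vanish.\<close>

lemma psd_kernel_gram:
  assumes "psd_kernel n F"
  shows "\<exists>f. \<forall>i<n. \<forall>j<n. F i j = (\<Sum>a<n. f i a * cnj (f j a))"
  using assms
proof (induction n arbitrary: F)
  case (Suc n)
  note F = Suc.prems
  define F' where "F' = (\<lambda>i j. F i j - F i n * F n j / F n n)"
  obtain f where f: "\<And>i j. i < n \<Longrightarrow> j < n \<Longrightarrow> F' i j = (\<Sum>a<n. f i a * cnj (f j a))"
    using Suc.IH[OF psd_kernel_restrict[OF psd_kernel_schur_complement[OF F]], of n]
    unfolding F'_def by auto
  \<comment> \<open>A triangular factor: column \<open>n\<close> is the pivot column divided by the
    square root of the pivot, the earlier columns come from the induction hypothesis and are zero in
    row \<open>n\<close>.\<close>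
  define g where "g = (\<lambda>i a. if a = n then F i n / complex_of_real (sqrt (Re (F n n)))
    else if i = n then 0 else f i a)"
  have herm: "F j i = cnj (F i j)" if "i < Suc n" "j < Suc n" for i j
    by (rule psd_kernel_sym[OF F that])
  have zero: "F i n = 0" if "F n n = 0" "i < Suc n" for i
    using psd_kernel_zero_diag[OF F] that by auto
  have F'n: "F' i n = 0" "F' n i = 0" if "i < Suc n" for i
    using zero[OF _ that] herm[OF that, of n] by (auto simp: F'_def)
  have sq: "complex_of_real (sqrt (Re (F n n))) * complex_of_real (sqrt (Re (F n n))) = F n n"
    using psd_kernel_diag[OF F, of n]
    by (simp flip: of_real_mult) (simp add: less_eq_complex_def complex_eq_iff)
  show ?case
  proof (intro exI[of _ g] allI impI)
    fix i j assume ij: "i < Suc n" "j < Suc n"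
    have "(\<Sum>a<n. g i a * cnj (g j a)) = F' i j"
    proof (cases "i = n \<or> j = n")
      case True
      then have "(\<Sum>a<n. g i a * cnj (g j a)) = 0"
        by (intro sum.neutral) (auto simp: g_def)
      then show ?thesis using True F'n ij by auto
    next
      case False
      then have "(\<Sum>a<n. g i a * cnj (g j a)) = (\<Sum>a<n. f i a * cnj (f j a))"
        by (intro sum.cong) (auto simp: g_def)
      then show ?thesis using f[of i j] ij False by simp
    qed
    moreover have "g i n * cnj (g j n) = F i n * F n j / F n n"
      using herm[of j n] ij by (simp add: g_def sq)
    ultimately show "F i j = (\<Sum>a<Suc n. g i a * cnj (g j a))"
      by (simp add: F'_def)
  qed
qed simp

lemma psd_kernel_hermitian_psd:
  assumes A: "A \<in> carrier_mat n n" and psd: "hermitian_psd A"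
  shows "psd_kernel n (\<lambda>i j. A $$ (i, j))"
  unfolding psd_kernel_def
proof (intro conjI allI impI)
  fix i j assume ij: "i < n" "j < n"
  have "mat_adjoint A = A" using psd by (simp add: hermitian_psd_def hermitian_def)
  then have "A $$ (j, i) = mat_adjoint A $$ (j, i)" by (rule arg_cong[OF sym])
  also have "\<dots> = cnj (A $$ (i, j))"
    using ij A by (simp add: mat_adjoint_def mat_of_rows_def)
  finally show "A $$ (j, i) = cnj (A $$ (i, j))" .
next
  fix c :: "nat \<Rightarrow> complex"
  have "0 \<le> (A *\<^sub>v vec n c) \<bullet>c vec n c" using psd A by (auto simp: hermitian_psd_def)
  also have "\<dots> = (\<Sum>i<n. \<Sum>j<n. cnj (c i) * A $$ (i, j) * c j)"
    using A by (auto simp: scalar_prod_def atLeast0LessThan sum_distrib_left mult_ac intro!: sum.cong)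
  finally show "0 \<le> (\<Sum>i<n. \<Sum>j<n. cnj (c i) * A $$ (i, j) * c j)" .
qed

section \<open>Leading eigenvectors and singular values\<close>

lemma cscalar_prod_self:
  fixes v :: "complex vec"
  shows "v \<bullet>c v = complex_of_real (\<Sum>i<dim_vec v. (cmod (v $ i))\<^sup>2)"
  unfolding of_real_sum complex_norm_square by (simp add: scalar_prod_def atLeast0LessThan)

lemma cscalar_prod_self_pos:
  fixes v :: "complex vec"
  assumes "v \<noteq> 0\<^sub>v (dim_vec v)"
  shows "0 < (\<Sum>i<dim_vec v. (cmod (v $ i))\<^sup>2)"
proof -
  obtain i where "i < dim_vec v" "v $ i \<noteq> 0"
    using assms by (metis eq_vecI index_zero_vec)
  then show ?thesis by (intro sum_pos2[of _ i]) auto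
qed

lemma cscalar_prod_adjoint:
  fixes B :: "complex mat"
  assumes B: "B \<in> carrier_mat n m" and v: "v \<in> carrier_vec n" and w: "w \<in> carrier_vec m"
  shows "(B *\<^sub>v w) \<bullet>c v = w \<bullet>c (mat_adjoint B *\<^sub>v v)"
proof -
  have "(B *\<^sub>v w) \<bullet>c v = (\<Sum>i<n. \<Sum>j<m. B $$ (i, j) * w $ j * cnj (v $ i))"
    using B v w by (auto simp: scalar_prod_def atLeast0LessThan sum_distrib_right intro!: sum.cong)
  also have "\<dots> = (\<Sum>j<m. \<Sum>i<n. B $$ (i, j) * w $ j * cnj (v $ i))"
    by (rule sum.swap)
  also have "\<dots> = w \<bullet>c (mat_adjoint B *\<^sub>v v)"
    using B v w by (auto simp: scalar_prod_def atLeast0LessThan sum_distrib_left mult_ac intro!: sum.cong)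
  finally show ?thesis .
qed

text \<open>For an eigenvector \<open>v\<close> and \<open>w = mat_adjoint B *\<^sub>v v\<close>,
  the eigenvalue times the squared norm of \<open>v\<close> is the squared norm of
  \<open>w\<close>.\<close>

lemma gram_eigenvalue_nonneg:
  fixes B :: "complex mat"
  assumes B: "B \<in> carrier_mat n m" and x: "x \<in># proots (char_poly (B * mat_adjoint B))"
  shows "0 \<le> Re x"
proof -
  let ?H = "B * mat_adjoint B"
  have H: "?H \<in> carrier_mat n n" using B by (auto intro!: mult_carrier_mat)
  have "eigenvalue ?H x"
    using x char_poly_neq_0[OF H] by (simp add: eigenvalue_root_char_poly[OF H])
  then obtain v where v: "v \<in> carrier_vec n" "v \<noteq> 0\<^sub>v n" "?H *\<^sub>v v = x \<cdot>\<^sub>v v"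
    using H by (auto simp: eigenvalue_def eigenvector_def)
  define w where "w = mat_adjoint B *\<^sub>v v"
  have w: "w \<in> carrier_vec m" using B v by (auto simp: w_def intro!: mult_mat_vec_carrier)
  have "?H *\<^sub>v v = B *\<^sub>v w"
    unfolding w_def by (rule assoc_mult_mat_vec) (use B v in auto)
  then have "(x \<cdot>\<^sub>v v) \<bullet>c v = w \<bullet>c w"
    using cscalar_prod_adjoint[OF B v(1) w] by (simp only: v(3) w_def)
  then have "x * (v \<bullet>c v) = w \<bullet>c w" using v(1) by simp
  then have "x * complex_of_real (\<Sum>i<n. (cmod (v $ i))\<^sup>2) = complex_of_real (\<Sum>i<m. (cmod (w $ i))\<^sup>2)"
    using v w by (simp add: cscalar_prod_self)
  then have "Re x * (\<Sum>i<n. (cmod (v $ i))\<^sup>2) = (\<Sum>i<m. (cmod (w $ i))\<^sup>2)"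
    by (drule_tac f = Re in arg_cong) (simp del: of_real_sum)
  also have "0 \<le> \<dots>" by (intro sum_nonneg) simp
  finally show ?thesis
    using cscalar_prod_self_pos[of v] v by (auto simp: zero_le_mult_iff)
qed

lemma count_image_mset_ge: "count A x \<le> count (image_mset f A) (f x)"
  by (induction A) auto

text \<open>The factors \<open>C\<close> and \<open>D\<close> witness rank at most \<open>p\<close>,
  so at least \<open>n - p\<close> eigenvalues are zero. The others are nonnegative, hence the
  \<open>p\<close> largest already sum to the trace.\<close>

lemma sum_leading_eigenvalues:
  fixes B C D :: "complex mat"
  assumes B: "B \<in> carrier_mat n m" and fact: "B * mat_adjoint B = C * D"
    and C: "C \<in> carrier_mat n p" and D: "D \<in> carrier_mat p n"
  shows "sum_list (take p (eigenvalues_desc (B * mat_adjoint B))) =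
    Re (\<Sum>i<n. (B * mat_adjoint B) $$ (i, i))"
proof -
  let ?H = "B * mat_adjoint B"
  let ?M = "proots (char_poly ?H)"
  have H: "?H \<in> carrier_mat n n" using B by (auto intro!: mult_carrier_mat)
  have mset: "mset (eigenvalues_desc ?H) = image_mset Re ?M"
    by (simp add: eigenvalues_desc_def)
  have "length (eigenvalues_desc ?H) = n"
    using degree_monic_char_poly[OF H] by (metis mset size_image_mset size_mset size_proots_complex)
  moreover have "n \<le> p + count (mset (eigenvalues_desc ?H)) 0"
  proof -
    have "n \<le> p + order 0 (char_poly ?H)" unfolding fact by (rule order_0_char_poly_mult[OF C D])
    also have "order 0 (char_poly ?H) = count ?M 0" using char_poly_neq_0[OF H] by simp
    \<comment> \<open>Taking real parts can merge eigenvalues, so the multiplicity of zero can only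
      grow.\<close>
    also have "\<dots> \<le> count (image_mset Re ?M) (Re 0)" by (rule count_image_mset_ge)
    finally show ?thesis by (simp add: mset)
  qed
  moreover have "\<forall>x\<in>set (eigenvalues_desc ?H). 0 \<le> x"
    unfolding set_mset_mset[symmetric] mset using gram_eigenvalue_nonneg[OF B] by auto
  moreover have "sorted (rev (eigenvalues_desc ?H))" by (simp add: eigenvalues_desc_def)
  ultimately have "sum_list (take p (eigenvalues_desc ?H)) = sum_list (eigenvalues_desc ?H)"
    by (intro sum_list_take_sorted_desc) auto
  also have "\<dots> = sum_mset (image_mset Re ?M)"
    by (simp add: mset flip: sum_mset_sum_list)
  also have "\<dots> = Re (sum_mset ?M)"
  proof -
    have "sum_mset (image_mset Re M) = Re (sum_mset M)" for M by (induction M) auto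
    then show ?thesis .
  qed
  finally show ?thesis by (simp add: trace_eq_sum_proots[OF H])
qed

lemma mat_adjoint_minus:
  fixes A B :: "complex mat"
  assumes "A \<in> carrier_mat n m" "B \<in> carrier_mat n m"
  shows "mat_adjoint (A - B) = mat_adjoint A - mat_adjoint B"
  using assms by (intro eq_matI) auto

lemma frobenius_zero:
  fixes K :: "complex mat"
  assumes K: "K \<in> carrier_mat n m" and tr: "(\<Sum>i<m. (mat_adjoint K * K) $$ (i, i)) = 0"
  shows "K = 0\<^sub>m n m"
proof -
  have "(\<Sum>j<m. (mat_adjoint K * K) $$ (j, j)) = complex_of_real (\<Sum>j<m. \<Sum>i<n. (cmod (K $$ (i, j)))\<^sup>2)"
    unfolding of_real_sum complex_norm_square using K
    by (intro sum.cong refl) (auto simp: scalar_prod_def atLeast0LessThan mult.commute)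
  then have "complex_of_real (\<Sum>j<m. \<Sum>i<n. (cmod (K $$ (i, j)))\<^sup>2) = 0"
    unfolding tr by (rule sym)
  then have "(\<Sum>j<m. \<Sum>i<n. (cmod (K $$ (i, j)))\<^sup>2) = 0" by (subst (asm) of_real_eq_0_iff)
  then have "\<forall>j<m. \<forall>i<n. K $$ (i, j) = 0"
    by (simp add: sum_nonneg_eq_0_iff sum_nonneg)
  then show ?thesis using K by (intro eq_matI) auto
qed

text \<open>With \<open>S = V\<^sup>* B\<close> and \<open>K = B - V S\<close>, the squared Frobenius norm of \<open>K\<close> is the trace of \<open>B B\<^sup>*\<close>
  minus the sum of its \<open>p\<close> largest eigenvalues; it is zero since the rank is at most \<open>p\<close>.\<close>

lemma leading_eigenvectors_projection:
  fixes B C D :: "complex mat"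
  assumes B: "B \<in> carrier_mat n m" and fact: "B * mat_adjoint B = C * D"
    and C: "C \<in> carrier_mat n p" and D: "D \<in> carrier_mat p n"
    and lead: "leading_eigenvectors (B * mat_adjoint B) p V"
  shows "V * (mat_adjoint V * B) = B"
proof -
  let ?H = "B * mat_adjoint B"
  have H: "?H \<in> carrier_mat n n" using B by (auto intro!: mult_carrier_mat)
  obtain d where V: "V \<in> carrier_mat n p"
    and orth: "\<And>i j. i < p \<Longrightarrow> j < p \<Longrightarrow> col V i \<bullet>c col V j = (if i = j then 1 else 0)"
    and eig: "\<And>j. j < p \<Longrightarrow> eigenvector ?H (col V j) (complex_of_real (d j))"
    and d: "image_mset d (mset_set {..<p}) = mset (take p (eigenvalues_desc ?H))"
    using lead B unfolding leading_eigenvectors_def by auto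
  have VV: "mat_adjoint V * V = 1\<^sub>m p"
  proof (rule eq_matI)
    fix i j assume "i < dim_row (1\<^sub>m p :: complex mat)" "j < dim_col (1\<^sub>m p :: complex mat)"
    then have ij: "i < p" "j < p" by auto
    have "(mat_adjoint V * V) $$ (i, j) = col V j \<bullet>c col V i"
      using V ij by (auto simp: scalar_prod_def mult.commute intro!: sum.cong)
    then show "(mat_adjoint V * V) $$ (i, j) = 1\<^sub>m p $$ (i, j)" using orth ij by auto
  qed (use V in auto)
  define S where "S = mat_adjoint V * B"
  have S: "S \<in> carrier_mat p m" using V B by (auto simp: S_def intro!: mult_carrier_mat)
  have aS: "mat_adjoint S = mat_adjoint B * V"
    unfolding S_def using V B by (subst mat_adjoint_mult[of _ p n _ m]) auto
  define K where "K = B - V * S"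
  have K: "K \<in> carrier_mat n m" using V S B by (auto simp: K_def)
  have VS: "V * S \<in> carrier_mat n m" using V S by auto
  have aV: "mat_adjoint V \<in> carrier_mat p n" and aB: "mat_adjoint B \<in> carrier_mat m n"
    and aSc: "mat_adjoint S \<in> carrier_mat m p" and aVS: "mat_adjoint (V * S) = mat_adjoint S * mat_adjoint V"
    using V S B by (auto simp: mat_adjoint_mult[of V n p S m])
  have trH: "(\<Sum>i<n. ?H $$ (i, i)) = (\<Sum>i<m. (mat_adjoint B * B) $$ (i, i))"
    by (rule trace_mult_commute) (use B in auto)
  \<comment> \<open>The diagonal of \<open>S S^*\<close> consists of the values of the form of
    \<open>?H\<close> at the columns of \<open>V\<close>, which are unit eigenvectors.\<close>
  have SS: "(S * mat_adjoint S) $$ (j, j) = complex_of_real (d j)" if j: "j < p" for j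
  proof -
    have "S * mat_adjoint S = mat_adjoint V * (?H * V)"
      unfolding aS unfolding S_def assoc_mult_mat[OF B aB V]
      by (rule assoc_mult_mat[OF aV B mult_carrier_mat[OF aB V]])
    then have "(S * mat_adjoint S) $$ (j, j) = (?H *\<^sub>v col V j) \<bullet>c col V j"
      using j V H by (auto simp: scalar_prod_def mult.commute intro!: sum.cong)
    also have "?H *\<^sub>v col V j = complex_of_real (d j) \<cdot>\<^sub>v col V j"
      using eig[OF j] by (simp add: eigenvector_def)
    also have "\<dots> \<bullet>c col V j = complex_of_real (d j)"
      using orth[OF j j] V j by simp
    finally show ?thesis .
  qed
  have "sum_list (take p (eigenvalues_desc ?H)) = (\<Sum>j<p. d j)"
    unfolding sum_mset_sum_list[symmetric] d[symmetric] by (simp add: sum_unfold_sum_mset)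
  then have "Re (\<Sum>i<n. ?H $$ (i, i)) = (\<Sum>j<p. d j)"
    using sum_leading_eigenvalues[OF B fact C D] by simp
  moreover have "Im (\<Sum>i<n. ?H $$ (i, i)) = 0"
    unfolding Im_sum using B by (intro sum.neutral) (auto simp: scalar_prod_def)
  ultimately have "(\<Sum>i<n. ?H $$ (i, i)) = (\<Sum>j<p. (S * mat_adjoint S) $$ (j, j))"
    by (simp add: SS complex_eq_iff)
  also have "\<dots> = (\<Sum>i<m. (mat_adjoint S * S) $$ (i, i))"
    by (rule trace_mult_commute[OF S aSc])
  finally have tr: "(\<Sum>i<m. (mat_adjoint B * B) $$ (i, i)) = (\<Sum>i<m. (mat_adjoint S * S) $$ (i, i))"
    by (simp only: trH)
  \<comment> \<open>Orthonormality makes \<open>K\<close> orthogonal to the columns of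
    \<open>V\<close>, so the cross terms collapse as in Pythagoras' theorem.\<close>
  have "mat_adjoint K * K = mat_adjoint B * B - mat_adjoint S * S"
  proof -
    have "mat_adjoint K = mat_adjoint B - mat_adjoint S * mat_adjoint V"
      unfolding K_def by (simp add: mat_adjoint_minus[OF B VS] aVS)
    also have "\<dots> * K = mat_adjoint B * K - mat_adjoint S * mat_adjoint V * K"
      by (rule minus_mult_distrib_mat[OF aB _ K]) (use aSc aV in auto)
    also have "mat_adjoint B * K = mat_adjoint B * B - mat_adjoint S * S"
      unfolding K_def mult_minus_distrib_mat[OF aB B VS] aS
      using assoc_mult_mat[OF aB V S] by simp
    also have "mat_adjoint S * mat_adjoint V * K = mat_adjoint S * (mat_adjoint V * K)"
      by (rule assoc_mult_mat[OF aSc aV K])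
    also have "mat_adjoint V * K = S - mat_adjoint V * (V * S)"
      using mult_minus_distrib_mat[OF aV B VS] by (simp only: K_def S_def)
    also have "mat_adjoint V * (V * S) = S"
      using assoc_mult_mat[OF aV V S] VV S by simp
    also have "mat_adjoint S * (S - S) = 0\<^sub>m m m"
      using S aSc by simp
    finally show ?thesis using aSc S aB B by (auto intro!: eq_matI)
  qed
  then have "(\<Sum>i<m. (mat_adjoint K * K) $$ (i, i)) =
      (\<Sum>i<m. (mat_adjoint B * B) $$ (i, i) - (mat_adjoint S * S) $$ (i, i))"
    using B S by simp
  also have "\<dots> = 0"
    using tr by (simp add: sum_subtractf)
  finally have "K = 0\<^sub>m n m" by (rule frobenius_zero[OF K])
  then have "B - V * S = 0\<^sub>m n m" by (simp add: K_def)
  then have "V * S = B"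
  proof -
    assume 0: "B - V * S = 0\<^sub>m n m"
    show ?thesis
    proof (rule eq_matI)
      fix i j assume ij: "i < dim_row B" "j < dim_col B"
      then show "(V * S) $$ (i, j) = B $$ (i, j)"
        using arg_cong[OF 0, of "\<lambda>A. A $$ (i, j)"] B VS by (simp del: index_mult_mat)
    qed (use VS B in auto)
  qed
  then show ?thesis by (simp add: S_def)
qed

section \<open>Two kernel vectors and the second-smallest singular value\<close>

text \<open>The kernel of \<open>A\<close> lies in that of its Gram matrix, so zero is an eigenvalue
  of the latter with multiplicity at least two. The condition \<open>m \<le> n\<close> ensures that
  this is the Gram matrix that defines the singular values.\<close>

lemma second_smallest_singular_value_le_0:
  assumes A: "A \<in> carrier_mat n m" and mn: "m \<le> n"
    and v: "v1 \<in> carrier_vec m" "v2 \<in> carrier_vec m" "A *\<^sub>v v1 = 0\<^sub>v n" "A *\<^sub>v v2 = 0\<^sub>v n"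
    and indep: "\<And>a b. a \<cdot>\<^sub>v v1 + b \<cdot>\<^sub>v v2 = 0\<^sub>v m \<Longrightarrow> a = 0 \<and> b = 0"
  shows "second_smallest_singular_value A \<le> 0"
proof -
  let ?G = "mat_adjoint A * A"
  have G: "?G \<in> carrier_mat m m" using A by (auto intro!: mult_carrier_mat)
  have ker: "?G *\<^sub>v v = 0\<^sub>v m" if "v \<in> carrier_vec m" "A *\<^sub>v v = 0\<^sub>v n" for v
  proof -
    have "?G *\<^sub>v v = mat_adjoint A *\<^sub>v (A *\<^sub>v v)"
      by (rule assoc_mult_mat_vec) (use A that in auto)
    also have "\<dots> = 0\<^sub>v m" unfolding that(2) using A by (intro eq_vecI) auto
    finally show ?thesis .
  qed
  have "2 \<le> order 0 (char_poly ?G)"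
    using order_0_char_poly_ge_2[OF G v(1,2) ker ker indep] v by blast
  also have "\<dots> = count (proots (char_poly ?G)) 0"
    using char_poly_neq_0[OF G] by simp
  also have "\<dots> \<le> count (singular_values A) 0"
    using count_image_mset_ge[of "proots (char_poly ?G)" 0 "\<lambda>x. sqrt (Re x)"] A mn
    by (simp add: singular_values_def)
  finally show ?thesis
    unfolding second_smallest_singular_value_def by (intro sorted_nth_1_le_0) auto
qed

section \<open>Circulant phases\<close>

lemma sub_mod_less [simp]: "L > 0 \<Longrightarrow> sub_mod L a b < L"
  by (simp add: sub_mod_def nat_less_iff)

lemma int_sub_mod: "L > 0 \<Longrightarrow> int (sub_mod L a b) = (int a - int b) mod int L"
  by (simp add: sub_mod_def)

text \<open>A common shift cancels in a difference. This is why circulant phases disappear from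
  \<open>H_mat L X i i\<close>.\<close>

lemma sub_mod_shift:
  assumes L: "L > 0"
  shows "sub_mod L (sub_mod L m i) (sub_mod L k i) = sub_mod L m k"
proof -
  have "int (sub_mod L (sub_mod L m i) (sub_mod L k i)) =
      ((int m - int i) mod int L - (int k - int i) mod int L) mod int L"
    using L by (simp add: int_sub_mod)
  also have "\<dots> = (int m - int k) mod int L"
    by (simp add: mod_diff_eq)
  also have "\<dots> = int (sub_mod L m k)" using L by (simp add: int_sub_mod)
  finally show ?thesis by simp
qed

text \<open>Shifting the column once more than the row lowers the difference by one; hence the
  pairing of each phase with its predecessor.\<close>

lemma sub_mod_shift_Suc:
  assumes L: "L > 0"
  shows "sub_mod L (sub_mod L m ((i + 1) mod L)) (sub_mod L k i) = sub_mod L (sub_mod L m k) 1"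
proof -
  have "int (sub_mod L (sub_mod L m ((i + 1) mod L)) (sub_mod L k i)) =
      ((int m - (int i + 1) mod int L) mod int L - (int k - int i) mod int L) mod int L"
    using L by (simp add: int_sub_mod zmod_int add.commute)
  also have "\<dots> = ((int m - (int i + 1)) - (int k - int i)) mod int L"
    by (simp only: mod_diff_right_eq mod_diff_left_eq)
  also have "\<dots> = ((int m - int k) mod int L - 1) mod int L"
    by (simp add: mod_diff_left_eq algebra_simps)
  also have "\<dots> = int (sub_mod L (sub_mod L m k) 1)" using L by (simp add: int_sub_mod)
  finally show ?thesis by simp
qed

lemma sub_mod_mod_right: "L > 0 \<Longrightarrow> sub_mod L a (b mod L) = sub_mod L a b"
  by (simp add: sub_mod_def zmod_int mod_diff_right_eq)

lemma sub_mod_self [simp]: "sub_mod L a a = 0"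
  by (simp add: sub_mod_def)

lemma sub_mod_0_right [simp]: "a < L \<Longrightarrow> sub_mod L a 0 = a"
  by (simp add: sub_mod_def)

lemma sub_mod_le: "b \<le> a \<Longrightarrow> a < L \<Longrightarrow> sub_mod L a b = a - b"
  by (simp add: sub_mod_def flip: of_nat_diff)

lemma sub_mod_add_mod: "L > 0 \<Longrightarrow> (sub_mod L a b + b) mod L = a mod L"
proof -
  assume L: "L > 0"
  have "int ((sub_mod L a b + b) mod L) = ((int a - int b) mod int L + int b) mod int L"
    using L by (simp add: zmod_int int_sub_mod)
  also have "\<dots> = int (a mod L)" by (simp add: mod_add_left_eq zmod_int)
  finally show ?thesis by simp
qed

section \<open>The matrices \<open>H_mat\<close> under circulant phases\<close>

lemma circulant_carrier [simp]: "z \<in> carrier_vec L \<Longrightarrow> circulant z \<in> carrier_mat L L"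
  by (auto simp: circulant_def)

lemma index_circulant:
  "z \<in> carrier_vec L \<Longrightarrow> i < L \<Longrightarrow> j < L \<Longrightarrow> circulant z $$ (i, j) = z $ sub_mod L j i"
  by (auto simp: circulant_def)

lemma hadamard_carrier [simp]: "A \<in> carrier_mat n m \<Longrightarrow> A \<odot> B \<in> carrier_mat n m"
  by (auto simp: hadamard_def)

lemma dim_hadamard [simp]: "dim_row (A \<odot> B) = dim_row A" "dim_col (A \<odot> B) = dim_col A"
  by (simp_all add: hadamard_def)

lemma index_hadamard:
  "A \<in> carrier_mat n m \<Longrightarrow> i < n \<Longrightarrow> j < m \<Longrightarrow> (A \<odot> B) $$ (i, j) = A $$ (i, j) * B $$ (i, j)"
  by (auto simp: hadamard_def)

lemma H_mat_carrier [simp]: "X \<in> carrier_mat L L \<Longrightarrow> H_mat L X i j \<in> carrier_mat L L"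
  by (simp add: H_mat_def)

lemma dim_H_mat [simp]: "dim_row (H_mat L X i j) = dim_row X" "dim_col (H_mat L X i j) = dim_col X"
  by (simp_all add: H_mat_def)

lemma index_H_mat:
  assumes "X \<in> carrier_mat L L" "k < L" "m < L"
  shows "H_mat L X i j $$ (k, m) = X $$ (k, m) * cnj (X $$ (sub_mod L k i, sub_mod L m j))"
  using assms by (simp add: H_mat_def index_hadamard shift_mat_def mat_cnj_def)

text \<open>With equal shifts every unimodular phase meets its own conjugate.\<close>

lemma H_mat_circulant_diag:
  assumes X: "X \<in> carrier_mat L L" and w: "w \<in> carrier_vec L" "\<And>m. m < L \<Longrightarrow> cmod (w $ m) = 1"
  shows "H_mat L (X \<odot> circulant w) i i = H_mat L X i i"
proof (rule eq_matI)
  fix k m assume "k < dim_row (H_mat L X i i)" "m < dim_col (H_mat L X i i)"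
  then have km: "k < L" "m < L" using X by auto
  then have L: "L > 0" by simp
  have "w $ sub_mod L m k * cnj (w $ sub_mod L m k) = 1"
    using w(2)[of "sub_mod L m k"] L by (simp flip: complex_norm_square)
  then show "H_mat L (X \<odot> circulant w) i i $$ (k, m) = H_mat L X i i $$ (k, m)"
    using X w km L by (simp add: index_H_mat index_hadamard index_circulant sub_mod_shift)
qed (use X in auto)

lemma H_mat_circulant_Suc:
  assumes X: "X \<in> carrier_mat L L" and w: "w \<in> carrier_vec L"
  shows "H_mat L (X \<odot> circulant w) i ((i + 1) mod L) =
    H_mat L X i ((i + 1) mod L) \<odot> circulant (vec L (\<lambda>m. w $ m * cnj (w $ sub_mod L m 1)))"
proof (rule eq_matI)
  fix k m
  assume "k < dim_row (H_mat L X i ((i + 1) mod L) \<odot> circulant (vec L (\<lambda>m. w $ m * cnj (w $ sub_mod L m 1))))"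
    "m < dim_col (H_mat L X i ((i + 1) mod L) \<odot> circulant (vec L (\<lambda>m. w $ m * cnj (w $ sub_mod L m 1))))"
  then have km: "k < L" "m < L" using X by auto
  then have L: "L > 0" by simp
  show "H_mat L (X \<odot> circulant w) i ((i + 1) mod L) $$ (k, m) =
    (H_mat L X i ((i + 1) mod L) \<odot> circulant (vec L (\<lambda>m. w $ m * cnj (w $ sub_mod L m 1)))) $$ (k, m)"
    using X w km L sub_mod_shift_Suc[OF L, of m i k]
    by (simp add: index_H_mat index_hadamard[of _ L L] index_circulant)
qed (use X in auto)

text \<open>Row \<open>k\<close> is the tensor product of \<open>p\<^sub>k\<close> with the conjugate of \<open>p\<^sub>k\<^sub>-\<^sub>i\<close>.\<close>

definition shift_prod :: "nat \<Rightarrow> nat \<Rightarrow> (nat \<Rightarrow> nat \<Rightarrow> complex) \<Rightarrow> nat \<Rightarrow> complex mat" where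
  "shift_prod L d p i = mat L (d * d) (\<lambda>(k, c). p k (c div d) * cnj (p (sub_mod L k i) (c mod d)))"

lemma shift_prod_carrier [simp]: "shift_prod L d p i \<in> carrier_mat L (d * d)"
  by (simp add: shift_prod_def)

text \<open>A single index below \<open>q * p\<close> encodes a pair, the flattening shared by
  \<open>shift_prod\<close>, \<open>vectorize\<close> and the Kronecker product.\<close>

lemma sum_mod_div:
  fixes g :: "nat \<Rightarrow> nat \<Rightarrow> 'a::comm_monoid_add"
  shows "(\<Sum>k<q * p. g (k mod p) (k div p)) = (\<Sum>b<q. \<Sum>a<p. g a b)"
proof -
  have "(\<Sum>k<q * p. g (k mod p) (k div p)) = (\<Sum>b<q. \<Sum>k = b * p..<b * p + p. g (k mod p) (k div p))"
    by (rule sum.nat_group[symmetric])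
  also have "\<dots> = (\<Sum>b<q. \<Sum>a<p. g a b)"
  proof (rule sum.cong[OF refl])
    fix b
    show "(\<Sum>k = b * p..<b * p + p. g (k mod p) (k div p)) = (\<Sum>a<p. g a b)"
      using sum.shift_bounds_nat_ivl[of "\<lambda>k. g (k mod p) (k div p)" 0 "b * p" p]
      by (simp add: add.commute atLeast0LessThan)
  qed
  finally show ?thesis .
qed

text \<open>Entrywise products of matrices factor through the tensor product of their inner
  dimensions. For a rank factorization with \<open>d = r\<close> this bounds the rank of
  \<open>H_mat L X i i\<close> by the square of \<open>r\<close>.\<close>

lemma H_mat_factorization:
  assumes X: "X \<in> carrier_mat L L"
    and fact: "\<And>k m. k < L \<Longrightarrow> m < L \<Longrightarrow> X $$ (k, m) = (\<Sum>a<d. p k a * q m a)"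
  shows "H_mat L X i j = shift_prod L d p i * transpose_mat (shift_prod L d q j)"
proof (rule eq_matI)
  fix k m
  assume "k < dim_row (shift_prod L d p i * transpose_mat (shift_prod L d q j))"
    "m < dim_col (shift_prod L d p i * transpose_mat (shift_prod L d q j))"
  then have km: "k < L" "m < L" by (auto simp: shift_prod_def)
  then have L: "L > 0" by simp
  let ?k = "sub_mod L k i" and ?m = "sub_mod L m j"
  have "(shift_prod L d p i * transpose_mat (shift_prod L d q j)) $$ (k, m) =
      (\<Sum>c<d * d. (p k (c div d) * cnj (p ?k (c mod d))) * (q m (c div d) * cnj (q ?m (c mod d))))"
    using km by (simp add: shift_prod_def scalar_prod_def atLeast0LessThan)
  also have "\<dots> = (\<Sum>a<d. \<Sum>b<d. (p k a * cnj (p ?k b)) * (q m a * cnj (q ?m b)))"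
    by (rule sum_mod_div)
  also have "\<dots> = (\<Sum>a<d. p k a * q m a) * cnj (\<Sum>b<d. p ?k b * q ?m b)"
    by (simp add: sum_product mult_ac)
  also have "\<dots> = H_mat L X i j $$ (k, m)"
    using km L by (simp add: index_H_mat[OF X] fact)
  finally show "H_mat L X i j $$ (k, m) =
      (shift_prod L d p i * transpose_mat (shift_prod L d q j)) $$ (k, m)" ..
qed (use X in \<open>auto simp: shift_prod_def\<close>)

text \<open>The left factor depends only on \<open>i\<close> and the right one only on
  \<open>j\<close>. The off-diagonal \<open>H_mat\<close> is thus built from the same factors as the
  diagonal ones, about which the eigenvectors give information.\<close>

lemma H_mat_gram:
  assumes X: "X \<in> carrier_mat L L"
    and fact: "\<And>k m. k < L \<Longrightarrow> m < L \<Longrightarrow> X $$ (k, m) = (\<Sum>a<d. f k a * cnj (f m a))"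
  shows "H_mat L X i j = shift_prod L d f i * mat_adjoint (shift_prod L d f j)"
proof -
  have "transpose_mat (shift_prod L d (\<lambda>m a. cnj (f m a)) j) = mat_adjoint (shift_prod L d f j)"
    by (rule eq_matI) (auto simp: shift_prod_def)
  then show ?thesis
    using H_mat_factorization[OF X, where d = d and p = f and q = "\<lambda>m a. cnj (f m a)"] fact by simp
qed

text \<open>Projecting onto the columns of \<open>U\<close> and \<open>U'\<close> fixes the two Gram
  factors, so the middle matrix is the product of their coordinate matrices \<open>S\<close> and
  \<open>mat_adjoint S'\<close>. The matrices \<open>C\<close> and \<open>D\<close> supply the rank
  bound that the projection requires.\<close>

lemma H_mat_in_leading_range:
  assumes Y: "Y \<in> carrier_mat L L" and psd: "hermitian_psd Y"
    and fact: "\<And>i. C i \<in> carrier_mat L p" "\<And>i. D i \<in> carrier_mat p L" "\<And>i. H_mat L Y i i = C i * D i"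
    and lead: "leading_eigenvectors (H_mat L Y i i) p U" "leading_eigenvectors (H_mat L Y j j) p U'"
  shows "\<exists>T \<in> carrier_mat p p. H_mat L Y i j = U * T * mat_adjoint U'"
proof -
  obtain f where f: "\<forall>k<L. \<forall>m<L. Y $$ (k, m) = (\<Sum>a<L. f k a * cnj (f m a))"
    using psd_kernel_gram[OF psd_kernel_hermitian_psd[OF Y psd]] by blast
  define B where "B = shift_prod L L f"
  have gram: "H_mat L Y i j = B i * mat_adjoint (B j)" for i j
    unfolding B_def by (rule H_mat_gram[OF Y]) (use f in auto)
  have B: "B i \<in> carrier_mat L (L * L)" for i by (simp add: B_def)
  have proj: "U * (mat_adjoint U * B i) = B i" "U' * (mat_adjoint U' * B j) = B j"
    using leading_eigenvectors_projection[OF B, of i "C i" "D i" p U]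
      leading_eigenvectors_projection[OF B, of j "C j" "D j" p U'] fact lead
    by (simp_all flip: gram)
  have U: "U \<in> carrier_mat L p" "U' \<in> carrier_mat L p"
    using lead Y unfolding leading_eigenvectors_def by auto
  define S where "S = mat_adjoint U * B i"
  define S' where "S' = mat_adjoint U' * B j"
  have S: "S \<in> carrier_mat p (L * L)" "S' \<in> carrier_mat p (L * L)"
    using U B by (auto simp: S_def S'_def intro!: mult_carrier_mat)
  have aS: "mat_adjoint S' \<in> carrier_mat (L * L) p" and aU: "mat_adjoint U' \<in> carrier_mat p L"
    using S U by auto
  have "H_mat L Y i j = (U * S) * mat_adjoint (U' * S')"
    unfolding gram S_def S'_def proj ..
  also have "\<dots> = (U * S) * (mat_adjoint S' * mat_adjoint U')"
    by (simp add: mat_adjoint_mult[OF U(2) S(2)])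
  also have "\<dots> = U * S * mat_adjoint S' * mat_adjoint U'"
    using U S by (intro assoc_mult_mat[symmetric, OF _ aS aU]) auto
  also have "U * S * mat_adjoint S' = U * (S * mat_adjoint S')"
    by (rule assoc_mult_mat[OF U(1) S(1) aS])
  finally show ?thesis
    using mult_carrier_mat[OF S(1) aS] by blast
qed

section \<open>The kernel of W\<close>

definition concat_vec :: "'a vec list \<Rightarrow> 'a vec" where
  "concat_vec ts = foldr (@\<^sub>v) ts vNil"

lemma concat_vec_simps [simp]:
  "concat_vec [] = vNil" "concat_vec (t # ts) = t @\<^sub>v concat_vec ts"
  by (simp_all add: concat_vec_def)

lemma dim_concat_vec: "dim_vec (concat_vec ts) = sum_list (map dim_vec ts)"
  by (induction ts) auto

lemma concat_vec_index:
  assumes "\<And>t. t \<in> set ts \<Longrightarrow> dim_vec t = N" "k < length ts * N"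
  shows "concat_vec ts $ k = ts ! (k div N) $ (k mod N)"
  using assms
proof (induction ts arbitrary: k)
  case (Cons t ts)
  have N: "N > 0" using Cons.prems(2) by (cases N) auto
  have dim: "dim_vec (concat_vec ts) = length ts * N"
    using Cons.prems(1) by (simp add: dim_concat_vec sum_list_triv cong: map_cong)
  show ?case
  proof (cases "k < N")
    case True
    then show ?thesis using Cons.prems by simp
  next
    case False
    then have k: "k = (k - N) + N" "k - N < length ts * N" using Cons.prems(2) by auto
    have "concat_vec (t # ts) $ k = concat_vec ts $ (k - N)"
      using False Cons.prems dim k(2) by simp
    also have "\<dots> = ts ! ((k - N) div N) $ ((k - N) mod N)"
      using Cons.IH[OF _ k(2)] Cons.prems(1) by simp
    also have "\<dots> = (t # ts) ! (k div N) $ (k mod N)"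
      using False N by (simp add: le_div_geq le_mod_geq)
    finally show ?thesis .
  qed
qed simp

text \<open>A list of pairs keeps each block together with its segment of the vector during the
  induction.\<close>

lemma diag_block_mat_mult_concat_vec:
  fixes zs :: "('a::comm_semiring_0 mat \<times> 'a vec) list"
  assumes "\<And>A t. (A, t) \<in> set zs \<Longrightarrow> t \<in> carrier_vec (dim_col A)"
  shows "diag_block_mat (map fst zs) *\<^sub>v concat_vec (map snd zs) =
    concat_vec (map (\<lambda>(A, t). A *\<^sub>v t) zs)"
  using assms
proof (induction zs)
  case Nil
  show ?case by (intro eq_vecI) auto
next
  case (Cons z zs)
  obtain A t where z: "z = (A, t)" by force
  let ?D = "diag_block_mat (map fst zs)" and ?t = "concat_vec (map snd zs)"
  have t: "t \<in> carrier_vec (dim_col A)" using Cons.prems z by auto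
  have "map dim_col (map fst zs) = map dim_vec (map snd zs)"
    using Cons.prems by force
  then have ts: "?t \<in> carrier_vec (dim_col ?D)"
    by (simp only: dim_concat_vec dim_diag_block_mat carrier_vec_def mem_Collect_eq)
  have "diag_block_mat (map fst (z # zs)) *\<^sub>v concat_vec (map snd (z # zs)) =
      (A *\<^sub>v t + 0\<^sub>m (dim_row A) (dim_col ?D) *\<^sub>v ?t) @\<^sub>v (0\<^sub>m (dim_row ?D) (dim_col A) *\<^sub>v t + ?D *\<^sub>v ?t)"
    unfolding z by (simp add: Let_def) (rule four_block_mat_mult_vec[OF _ _ _ _ t ts], auto)
  also have "0\<^sub>m (dim_row A) (dim_col ?D) *\<^sub>v ?t = 0\<^sub>v (dim_row A)"
    using ts by (intro eq_vecI) auto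
  also have "0\<^sub>m (dim_row ?D) (dim_col A) *\<^sub>v t = 0\<^sub>v (dim_row ?D)"
    using t by (intro eq_vecI) auto
  also have "A *\<^sub>v t + 0\<^sub>v (dim_row A) = A *\<^sub>v t"
    by (intro eq_vecI) auto
  also have "0\<^sub>v (dim_row ?D) + ?D *\<^sub>v ?t = ?D *\<^sub>v ?t"
    by (intro eq_vecI) auto
  also have "?D *\<^sub>v ?t = concat_vec (map (\<lambda>(A, t). A *\<^sub>v t) zs)"
    using Cons by auto
  finally show ?case by (simp add: z)
qed

text \<open>The standard vectorization identity, in the form that turns \<open>V T V'^*\<close> into
  the product of a \<open>Z_mat\<close> block with a vector.\<close>

lemma kronecker_mult_vectorize:
  assumes A: "A \<in> carrier_mat n p" and B: "B \<in> carrier_mat m q" and T: "T \<in> carrier_mat p q"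
  shows "(mat_cnj B \<otimes>\<^sub>K A) *\<^sub>v vectorize T = vectorize (A * T * mat_adjoint B)"
proof (rule eq_vecI)
  fix k assume "k < dim_vec (vectorize (A * T * mat_adjoint B))"
  then have k: "k < n * m" using A B by (simp add: vectorize_def)
  then have kk: "k mod n < n" "k div n < m"
    by (auto simp: less_mult_imp_div_less mult.commute) (cases n, auto)
  have k': "k < m * n" using k by (simp add: mult.commute)
  have "((mat_cnj B \<otimes>\<^sub>K A) *\<^sub>v vectorize T) $ k =
      (\<Sum>j<q * p. cnj (B $$ (k div n, j div p)) * A $$ (k mod n, j mod p) * T $$ (j mod p, j div p))"
    using A B T k' kk by (auto simp: kronecker_def mat_cnj_def vectorize_def scalar_prod_def
        atLeast0LessThan mult.commute[of p q] less_mult_imp_div_less intro!: sum.cong)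
  also have "\<dots> = (\<Sum>b<q. \<Sum>a<p. cnj (B $$ (k div n, b)) * A $$ (k mod n, a) * T $$ (a, b))"
    by (rule sum_mod_div)
  also have "\<dots> = (A * T * mat_adjoint B) $$ (k mod n, k div n)"
    using A B T kk by (auto simp: scalar_prod_def atLeast0LessThan sum_distrib_left sum_distrib_right
        mult_ac intro!: sum.cong)
  also have "\<dots> = vectorize (A * T * mat_adjoint B) $ k"
    using A B k by (simp add: vectorize_def)
  finally show "((mat_cnj B \<otimes>\<^sub>K A) *\<^sub>v vectorize T) $ k = vectorize (A * T * mat_adjoint B) $ k" .
qed (use A B in \<open>auto simp: kronecker_def mat_cnj_def vectorize_def\<close>)

section \<open>Kernel vectors of \<open>W_mat\<close> from circulant phases\<close>

text \<open>The circulants of the unit vectors have disjoint supports covering all positions, so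
  each entry of the sum over columns retains a single coordinate of \<open>z\<close>.\<close>

lemma M_mat_mult_vec:
  assumes X: "X \<in> carrier_mat L L" and z: "z \<in> carrier_vec L" and k: "k < L ^ 3"
  shows "(M_mat L X *\<^sub>v z) $ k =
    vectorize (H_mat L X (k div L\<^sup>2) ((k div L\<^sup>2 + 1) mod L) \<odot> circulant z) $ (k mod L\<^sup>2)"
proof -
  let ?i = "k div L\<^sup>2" and ?s = "k mod L\<^sup>2"
  have L: "L > 0" using k by (cases L) auto
  have s: "?s < L * L" using L by (simp add: power2_eq_square)
  have s': "?s mod L < L" "?s div L < L" using L s by (auto simp: less_mult_imp_div_less)
  \<comment> \<open>Column minus row of the position that column stacking places at
    \<open>?s\<close>: the one \<open>m\<close> whose circulant is nonzero there.\<close>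
  let ?d = "sub_mod L (?s div L) (?s mod L)"
  have "(M_mat L X *\<^sub>v z) $ k = (\<Sum>m<L. M_block L X ?i m $ ?s * z $ m)"
    using k z by (simp add: M_mat_def scalar_prod_def atLeast0LessThan)
  also have "\<dots> = (\<Sum>m<L. if m = ?d then H_mat L X ?i ((?i + 1) mod L) $$ (?s mod L, ?s div L) * z $ m else 0)"
  proof (rule sum.cong[OF refl])
    fix m assume "m \<in> {..<L}"
    then show "M_block L X ?i m $ ?s * z $ m =
        (if m = ?d then H_mat L X ?i ((?i + 1) mod L) $$ (?s mod L, ?s div L) * z $ m else 0)"
      using X s s' L by (auto simp: M_block_def hadamard_vec_def vectorize_def index_circulant
          circulant_def)
  qed
  also have "\<dots> = H_mat L X ?i ((?i + 1) mod L) $$ (?s mod L, ?s div L) * z $ ?d"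
    using L by simp
  also have "\<dots> = vectorize (H_mat L X ?i ((?i + 1) mod L) \<odot> circulant z) $ ?s"
    using X z s s' by (simp add: vectorize_def index_hadamard[of _ L L] index_circulant)
  finally show ?thesis .
qed

text \<open>Block row \<open>i\<close> of both parts of \<open>W_mat\<close> yields the same
  vectorized matrix, once with a plus and once with a minus sign.\<close>

lemma W_mat_kernel:
  assumes X: "X \<in> carrier_mat L L" and z: "z \<in> carrier_vec L"
    and V: "\<And>i. i < L \<Longrightarrow> V i \<in> carrier_mat L p"
    and T: "\<And>i. i < L \<Longrightarrow> T i \<in> carrier_mat p p"
    and HT: "\<And>i. i < L \<Longrightarrow> H_mat L X i ((i + 1) mod L) \<odot> circulant z =
      V i * T i * mat_adjoint (V ((i + 1) mod L))"
  shows "W_mat L X V *\<^sub>v (z @\<^sub>v concat_vec (map (\<lambda>i. vectorize (T i)) [0..<L])) = 0\<^sub>v (L ^ 3)"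
proof -
  let ?D = "diag_block_mat (map (Z_mat L V) [0..<L])"
  let ?t = "concat_vec (map (\<lambda>i. vectorize (T i)) [0..<L])"
  let ?h = "\<lambda>i. vectorize (H_mat L X i ((i + 1) mod L) \<odot> circulant z)"
  have Z: "dim_row (Z_mat L V i) = L * L" "dim_col (Z_mat L V i) = p * p" if "i < L" for i
  proof -
    have "V i \<in> carrier_mat L p" "V ((i + 1) mod L) \<in> carrier_mat L p" using V that by auto
    then show "dim_row (Z_mat L V i) = L * L" "dim_col (Z_mat L V i) = p * p"
      by (auto simp: Z_mat_def kronecker_def mat_cnj_def)
  qed
  have tdim: "dim_vec (vectorize (T i)) = p * p" if "i < L" for i
    using T[OF that] by (auto simp: vectorize_def)
  have "map dim_row (map (Z_mat L V) [0..<L]) = map (\<lambda>_. L * L) [0..<L]"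
    "map dim_col (map (Z_mat L V) [0..<L]) = map (\<lambda>_. p * p) [0..<L]"
    using Z by simp_all
  then have dD: "dim_row ?D = L ^ 3" "dim_col ?D = L * (p * p)"
    by (simp_all only: dim_diag_block_mat) (simp_all add: sum_list_triv power3_eq_cube)
  have "map dim_vec (map (\<lambda>i. vectorize (T i)) [0..<L]) = map (\<lambda>_. p * p) [0..<L]"
    using tdim by simp
  then have t: "?t \<in> carrier_vec (dim_col ?D)"
    unfolding dD carrier_vec_def mem_Collect_eq dim_concat_vec by (simp only:) (simp add: sum_list_triv)
  let ?zs = "map (\<lambda>i. (Z_mat L V i, vectorize (T i))) [0..<L]"
  have "diag_block_mat (map fst ?zs) *\<^sub>v concat_vec (map snd ?zs) =
      concat_vec (map (\<lambda>(A, t). A *\<^sub>v t) ?zs)"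
    by (rule diag_block_mat_mult_concat_vec) (use Z tdim in \<open>auto intro!: carrier_vecI\<close>)
  then have "?D *\<^sub>v ?t = concat_vec (map (\<lambda>i. Z_mat L V i *\<^sub>v vectorize (T i)) [0..<L])"
    by (simp add: comp_def)
  also have "map (\<lambda>i. Z_mat L V i *\<^sub>v vectorize (T i)) [0..<L] = map ?h [0..<L]"
  proof (rule map_cong[OF refl])
    fix i assume "i \<in> set [0..<L]"
    then have i: "i < L" "(i + 1) mod L < L" by auto
    show "Z_mat L V i *\<^sub>v vectorize (T i) = ?h i"
      unfolding HT[OF i(1)] Z_mat_def by (rule kronecker_mult_vectorize[OF V[OF i(1)] V[OF i(2)] T[OF i(1)]])
  qed
  finally have Dt: "?D *\<^sub>v ?t = concat_vec (map ?h [0..<L])" .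
  have M: "M_mat L X \<in> carrier_mat (L ^ 3) L" by (simp add: M_mat_def)
  have "M_mat L X *\<^sub>v z = ?D *\<^sub>v ?t"
  proof (rule eq_vecI)
    fix k assume "k < dim_vec (?D *\<^sub>v ?t)"
    then have k: "k < L ^ 3" using dD by simp
    then have kL: "k < L * (L * L)" by (simp add: power3_eq_cube)
    have hd: "dim_vec (?h i) = L * L" for i using X by (simp add: vectorize_def)
    have "(?D *\<^sub>v ?t) $ k = map ?h [0..<L] ! (k div (L * L)) $ (k mod (L * L))"
      unfolding Dt by (rule concat_vec_index) (use hd kL in auto)
    also have "\<dots> = ?h (k div (L * L)) $ (k mod (L * L))"
      using kL by (simp add: less_mult_imp_div_less)
    finally show "(M_mat L X *\<^sub>v z) $ k = (?D *\<^sub>v ?t) $ k"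
      by (simp add: M_mat_mult_vec[OF X z k] power2_eq_square)
  qed (use M dD in simp)
  moreover have "W_mat L X V *\<^sub>v (z @\<^sub>v ?t) =
      (M_mat L X *\<^sub>v z + (- ?D) *\<^sub>v ?t) @\<^sub>v (0\<^sub>m 0 L *\<^sub>v z + 0\<^sub>m 0 (dim_col ?D) *\<^sub>v ?t)"
    unfolding W_mat_def Let_def
    by (rule four_block_mat_mult_vec[OF M _ _ _ z t]) (use dD in auto)
  moreover have "(- ?D) *\<^sub>v ?t = - (?D *\<^sub>v ?t)"
    using t by (intro uminus_mult_mat_vec) auto
  ultimately show ?thesis
    using dD by (intro eq_vecI) auto
qed

text \<open>Since \<open>?Y\<close> has the same diagonal \<open>H_mat\<close> as \<open>X\<close>,
  the given \<open>V i\<close> are leading eigenvectors for it too, and its positive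
  semidefiniteness puts the next off-diagonal \<open>H_mat\<close> into their range. The lemma
  serves both for the phases that restore the original matrix and for the candidate phases.\<close>

lemma circulant_phase_kernel:
  assumes X: "X \<in> carrier_mat L L" and L: "L > 0"
    and w: "w \<in> carrier_vec L" "\<And>m. m < L \<Longrightarrow> cmod (w $ m) = 1"
    and psd: "hermitian_psd (X \<odot> circulant w)"
    and fact: "\<And>i. C i \<in> carrier_mat L p" "\<And>i. D i \<in> carrier_mat p L" "\<And>i. H_mat L X i i = C i * D i"
    and lead: "\<And>i. i < L \<Longrightarrow> leading_eigenvectors (H_mat L X i i) p (V i)"
  shows "\<exists>t \<in> carrier_vec (L * (p * p)). W_mat L X V *\<^sub>v
    (vec L (\<lambda>m. w $ m * cnj (w $ sub_mod L m 1)) @\<^sub>v t) = 0\<^sub>v (L ^ 3)"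
proof -
  let ?Y = "X \<odot> circulant w" and ?z = "vec L (\<lambda>m. w $ m * cnj (w $ sub_mod L m 1))"
  have Y: "?Y \<in> carrier_mat L L" using X by simp
  have diag: "H_mat L ?Y i i = H_mat L X i i" for i by (rule H_mat_circulant_diag[OF X w])
  have V: "V i \<in> carrier_mat L p" if "i < L" for i
    using lead[OF that] X by (auto simp: leading_eigenvectors_def)
  have "\<exists>T \<in> carrier_mat p p. H_mat L X i ((i + 1) mod L) \<odot> circulant ?z =
      V i * T * mat_adjoint (V ((i + 1) mod L))" if i: "i < L" for i
    unfolding H_mat_circulant_Suc[OF X w(1), symmetric]
    by (rule H_mat_in_leading_range[OF Y psd, of C p D]) (use fact lead i L in \<open>simp_all add: diag\<close>)
  then obtain T where T: "\<And>i. i < L \<Longrightarrow> T i \<in> carrier_mat p p"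
    "\<And>i. i < L \<Longrightarrow> H_mat L X i ((i + 1) mod L) \<odot> circulant ?z = V i * T i * mat_adjoint (V ((i + 1) mod L))"
    by metis
  let ?t = "concat_vec (map (\<lambda>i. vectorize (T i)) [0..<L])"
  have "map dim_vec (map (\<lambda>i. vectorize (T i)) [0..<L]) = map (\<lambda>_. p * p) [0..<L]"
    using T(1)[THEN carrier_matD(1)] T(1)[THEN carrier_matD(2)] by (simp add: vectorize_def)
  then have "?t \<in> carrier_vec (L * (p * p))"
    unfolding carrier_vec_def mem_Collect_eq dim_concat_vec by (simp only:) (simp add: sum_list_triv)
  moreover have "W_mat L X V *\<^sub>v (?z @\<^sub>v ?t) = 0\<^sub>v (L ^ 3)"
    by (rule W_mat_kernel[OF X _ V T]) auto
  ultimately show ?thesis by blast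
qed

section \<open>Identification of the phases\<close>

lemma phase_vec_carrier [simp]: "phase_vec L \<phi> \<in> carrier_vec L"
  by (simp add: phase_vec_def)

lemma cmod_phase_vec: "m < L \<Longrightarrow> cmod (phase_vec L \<phi> $ m) = 1"
  by (simp add: phase_vec_def)

lemma phase_vec_0: "0 < L \<Longrightarrow> phase_vec L \<phi> $ 0 = 1"
  by (simp add: phase_vec_def)

lemma cnj_phase_vec: "m < L \<Longrightarrow> cnj (phase_vec L \<phi> $ m) = phase_vec L (\<lambda>m. - \<phi> m) $ m"
  by (simp add: phase_vec_def cis_cnj cis_conv_exp[symmetric] del: of_real_minus)

text \<open>In rank one, \<open>S i 0 * S 0 i = S i i * S 0 0\<close>, and unimodular phases do not
  affect the product on the left. This makes the diagonal of the Schur complement vanish, and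
  positivity does the rest.\<close>

lemma rank_one_psd_phase_step:
  fixes S :: "complex mat" and u :: "complex vec"
  assumes S: "S \<in> carrier_mat L L" "hermitian_psd S" and rank: "vec_space.rank L S = 1"
    and nz: "\<And>i j. i < L \<Longrightarrow> j < L \<Longrightarrow> S $$ (i, j) \<noteq> 0"
    and u: "u \<in> carrier_vec L" "u $ 0 = 1" "\<And>m. m < L \<Longrightarrow> cmod (u $ m) = 1"
    and psd: "hermitian_psd (S \<odot> circulant u)" and L: "L > 0"
  shows "\<exists>c. \<forall>m<L. u $ m = c * u $ sub_mod L m 1"
proof -
  let ?Y = "\<lambda>i j. (S \<odot> circulant u) $$ (i, j)"
  obtain P Q where PQ: "P \<in> carrier_mat L 1" "Q \<in> carrier_mat 1 L" "S = P * Q"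
    using rank_factorization[OF S(1)] rank by auto
  have SPQ: "S $$ (i, j) = P $$ (i, 0) * Q $$ (0, j)" if "i < L" "j < L" for i j
    using PQ that by (simp add: scalar_prod_def)
  have Y: "?Y i j = S $$ (i, j) * u $ sub_mod L j i" if "i < L" "j < L" for i j
    using S u that by (simp add: index_hadamard index_circulant)
  note FS = psd_kernel_hermitian_psd[OF S]
  note FY = psd_kernel_hermitian_psd[OF hadamard_carrier[OF S(1)] psd]
  define G where "G = (\<lambda>i j. ?Y i j - ?Y i 0 * ?Y 0 j / ?Y 0 0)"
  have FG: "psd_kernel L G"
    unfolding G_def by (rule psd_kernel_schur_complement[OF FY L])
  have Gdiag: "G i i = 0" if i: "i < L" for i
  proof -
    have "?Y i 0 * ?Y 0 i = ?Y i 0 * cnj (?Y i 0)"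
      using psd_kernel_sym[OF FY i L] by simp
    also have "\<dots> = S $$ (i, 0) * cnj (S $$ (i, 0)) * (u $ sub_mod L 0 i * cnj (u $ sub_mod L 0 i))"
      using i L by (simp add: Y)
    also have "u $ sub_mod L 0 i * cnj (u $ sub_mod L 0 i) = 1"
      using u(3)[of "sub_mod L 0 i"] L by (simp flip: complex_norm_square)
    also have "cnj (S $$ (i, 0)) = S $$ (0, i)"
      using psd_kernel_sym[OF FS i L] by simp
    also have "S $$ (i, 0) * S $$ (0, i) * 1 = S $$ (i, i) * S $$ (0, 0)"
      using i L by (simp add: SPQ)
    finally show ?thesis
      using i L nz[of 0 0] u(2) by (simp add: G_def Y)
  qed
  \<comment> \<open>Index 1, or the only index 0 when \<open>L = 1\<close>.\<close>
  define i where "i = 1 mod L"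
  have i: "i < L" using L by (simp add: i_def)
  \<comment> \<open>Row \<open>i\<close> of the vanishing complement will read
    \<open>u_(m-1) = u_(-1) u_m\<close>; \<open>c\<close> is the inverse of the unimodular
    \<open>u_(-1)\<close>.\<close>
  define c where "c = cnj (u $ sub_mod L 0 i)"
  have "u $ m = c * u $ sub_mod L m 1" if m: "m < L" for m
  proof -
    have "G i m = 0" by (rule psd_kernel_zero_diag[OF FG m Gdiag[OF m] i])
    then have "?Y i m * ?Y 0 0 = ?Y i 0 * ?Y 0 m"
      using nz[of 0 0] L u(2) by (simp add: G_def Y field_simps)
    then have "S $$ (i, m) * S $$ (0, 0) * u $ sub_mod L m i =
        S $$ (i, 0) * S $$ (0, m) * (u $ sub_mod L 0 i * u $ m)"
      using i m L u(2) by (simp add: Y mult_ac)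
    moreover have "S $$ (i, 0) * S $$ (0, m) = S $$ (i, m) * S $$ (0, 0)"
      using i m L by (simp add: SPQ mult_ac)
    ultimately have "u $ sub_mod L m i = u $ sub_mod L 0 i * u $ m"
      using nz i m L by simp
    moreover have "c * u $ sub_mod L 0 i = 1"
      using u(3)[of "sub_mod L 0 i"] L by (simp add: c_def mult.commute flip: complex_norm_square)
    moreover have "sub_mod L m i = sub_mod L m 1"
      unfolding i_def by (rule sub_mod_mod_right[OF L])
    ultimately show ?thesis by (metis mult.assoc mult_1)
  qed
  then show ?thesis by blast
qed

text \<open>Cramer's rule on coordinates \<open>0\<close> and \<open>m\<close>: a nonzero minor of
  the upper parts forces both coefficients to vanish.\<close>

lemma append_vec_indep:
  fixes z1 z2 :: "'a::field vec"
  assumes z: "z1 \<in> carrier_vec n" "z2 \<in> carrier_vec n" and t: "t1 \<in> carrier_vec l" "t2 \<in> carrier_vec l"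
    and m: "m < n" "0 < n" "z2 $ m * z1 $ 0 \<noteq> z2 $ 0 * z1 $ m"
    and 0: "a \<cdot>\<^sub>v (z1 @\<^sub>v t1) + b \<cdot>\<^sub>v (z2 @\<^sub>v t2) = 0\<^sub>v (n + l)"
  shows "a = 0 \<and> b = 0"
proof -
  have e: "a * z1 $ k + b * z2 $ k = 0" if "k < n" for k
    using arg_cong[OF 0, of "\<lambda>v. v $ k"] that z t by simp
  have "b * (z2 $ m * z1 $ 0 - z2 $ 0 * z1 $ m) =
      (a * z1 $ m + b * z2 $ m) * z1 $ 0 - (a * z1 $ 0 + b * z2 $ 0) * z1 $ m"
    "a * (z2 $ m * z1 $ 0 - z2 $ 0 * z1 $ m) =
      (a * z1 $ 0 + b * z2 $ 0) * z2 $ m - (a * z1 $ m + b * z2 $ m) * z2 $ 0"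
    by (simp_all add: algebra_simps)
  then have "b * (z2 $ m * z1 $ 0 - z2 $ 0 * z1 $ m) = 0" "a * (z2 $ m * z1 $ 0 - z2 $ 0 * z1 $ m) = 0"
    by (simp_all only: e[OF m(1)] e[OF m(2)] mult_zero_left diff_zero)
  then show ?thesis using m(3) by simp
qed

lemma phase_step_of_singular_value:
  assumes S: "S \<in> carrier_mat L L" "hermitian_psd S" and rank: "vec_space.rank L S = r"
    and r: "real r < sqrt (real L)"
    and phase: "\<phi> = phase_vec L \<alpha>" "\<psi> = phase_vec L \<beta>" and X: "X = S \<odot> circulant \<phi>"
    and lead: "\<And>i. i < L \<Longrightarrow> leading_eigenvectors (H_mat L X i i) (r\<^sup>2) (V i)"
    and sv: "0 < second_smallest_singular_value (W_mat L X V)"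
    and psd: "hermitian_psd (X \<odot> circulant \<psi>)"
  shows "\<exists>c. \<forall>m<L. \<phi> $ m * \<psi> $ m = c * (\<phi> $ sub_mod L m 1 * \<psi> $ sub_mod L m 1)"
proof -
  have rL: "r\<^sup>2 < L"
    using r by (metis of_nat_less_iff of_nat_power real_less_rsqrt real_sqrt_less_iff real_sqrt_pow2_iff
        not_less real_le_lsqrt of_nat_0_le_iff)
  then have L: "L > 0" by simp
  have XC: "X \<in> carrier_mat L L" using S X by simp
  \<comment> \<open>The conjugate phases undo those of \<open>X\<close>, so
    \<open>X \<odot> circulant w\<close> is \<open>S\<close>, which is positive semidefinite by
    assumption.\<close>
  define w where "w = phase_vec L (\<lambda>m. - \<alpha> m)"
  have w\<phi>: "w $ m = cnj (\<phi> $ m)" if "m < L" for m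
    using cnj_phase_vec[OF that, of \<alpha>] by (simp add: w_def phase)
  have \<phi>1: "\<phi> $ m * cnj (\<phi> $ m) = 1" if "m < L" for m
    using cmod_phase_vec[OF that, of \<alpha>] by (simp add: phase flip: complex_norm_square)
  have \<psi>1: "\<psi> $ m * cnj (\<psi> $ m) = 1" if "m < L" for m
    using cmod_phase_vec[OF that, of \<beta>] by (simp add: phase flip: complex_norm_square)
  have carr: "w \<in> carrier_vec L" "\<phi> \<in> carrier_vec L" "\<psi> \<in> carrier_vec L" by (simp_all add: w_def phase)
  have Xw: "X \<odot> circulant w = S"
    using S carr L by (intro eq_matI)
      (auto simp: X index_hadamard[of _ L L] index_circulant w\<phi> \<phi>1 mult.assoc)
  have norm1: "cmod (w $ m) = 1" "cmod (\<psi> $ m) = 1" if "m < L" for m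
    using that by (simp_all add: w_def phase cmod_phase_vec)
  have psdw: "hermitian_psd (X \<odot> circulant w)" using S(2) Xw by simp
  obtain P Q where PQ: "P \<in> carrier_mat L r" "Q \<in> carrier_mat r L" "S = P * Q"
    using rank_factorization[OF S(1)] rank by auto
  define C where "C = shift_prod L r (\<lambda>k a. P $$ (k, a))"
  define D where "D = (\<lambda>i. transpose_mat (shift_prod L r (\<lambda>m a. Q $$ (a, m)) i))"
  have fact: "C i \<in> carrier_mat L (r\<^sup>2)" "D i \<in> carrier_mat (r\<^sup>2) L" "H_mat L X i i = C i * D i" for i
  proof -
    show "C i \<in> carrier_mat L (r\<^sup>2)" "D i \<in> carrier_mat (r\<^sup>2) L"
      by (simp_all add: C_def D_def power2_eq_square)
    \<comment> \<open>\<open>X\<close> itself may have large rank; the bound on its diagonal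
      \<open>H_mat\<close> is inherited from \<open>S\<close>.\<close>
    have "H_mat L X i i = H_mat L S i i"
      unfolding X phase by (rule H_mat_circulant_diag[OF S(1)]) (simp_all add: cmod_phase_vec)
    also have "\<dots> = C i * D i"
      unfolding C_def D_def by (rule H_mat_factorization[OF S(1)])
        (use PQ in \<open>simp add: scalar_prod_def atLeast0LessThan\<close>)
    finally show "H_mat L X i i = C i * D i" .
  qed
  let ?z1 = "vec L (\<lambda>m. w $ m * cnj (w $ sub_mod L m 1))"
  let ?z2 = "vec L (\<lambda>m. \<psi> $ m * cnj (\<psi> $ sub_mod L m 1))"
  let ?p = "r\<^sup>2"
  obtain t1 where t1: "t1 \<in> carrier_vec (L * (?p * ?p))" "W_mat L X V *\<^sub>v (?z1 @\<^sub>v t1) = 0\<^sub>v (L ^ 3)"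
    using circulant_phase_kernel[OF XC L carr(1) norm1(1) psdw fact lead] by (rule bexE)
  obtain t2 where t2: "t2 \<in> carrier_vec (L * (?p * ?p))" "W_mat L X V *\<^sub>v (?z2 @\<^sub>v t2) = 0\<^sub>v (L ^ 3)"
    using circulant_phase_kernel[OF XC L carr(3) norm1(2) psd fact lead] by (rule bexE)
  have W: "W_mat L X V \<in> carrier_mat (L ^ 3) (L + L * (?p * ?p))"
  proof -
    have "W_mat L X V \<in> carrier_mat (L ^ 3) (L + r ^ 4 * L)"
      by (rule W_mat_carrier) (use lead XC in \<open>auto simp: leading_eigenvectors_def\<close>)
    moreover have "r ^ 4 * L = L * (?p * ?p)" by (simp flip: power_add)
    ultimately show ?thesis by simp
  qed
  \<comment> \<open>\<open>W_mat\<close> has at least as many rows as columns because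
    \<open>r\<^sup>2 < L\<close>.\<close>
  have dims: "L + L * (?p * ?p) \<le> L ^ 3"
  proof -
    have "Suc (?p * ?p) \<le> L * L" using rL by (intro Suc_leI mult_strict_mono) auto
    then have "L * Suc (?p * ?p) \<le> L * (L * L)" by (rule mult_le_mono2)
    then show ?thesis by (simp add: power3_eq_cube)
  qed
  \<comment> \<open>Proportionality of the two upper parts in cross-multiplied form; a failure would
    give independent kernel vectors and a second-smallest singular value of at most zero.\<close>
  have ratio: "?z2 $ m * ?z1 $ 0 = ?z2 $ 0 * ?z1 $ m" if m: "m < L" for m
  proof (rule ccontr)
    assume neq: "?z2 $ m * ?z1 $ 0 \<noteq> ?z2 $ 0 * ?z1 $ m"
    have "second_smallest_singular_value (W_mat L X V) \<le> 0"
    proof (rule second_smallest_singular_value_le_0[OF W dims _ _ t1(2) t2(2)])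
      fix a b
      assume "a \<cdot>\<^sub>v (?z1 @\<^sub>v t1) + b \<cdot>\<^sub>v (?z2 @\<^sub>v t2) = 0\<^sub>v (L + L * (?p * ?p))"
      then show "a = 0 \<and> b = 0"
        by (rule append_vec_indep[OF _ _ t1(1) t2(1) m L neq, rotated 2]) auto
    qed (use t1(1) t2(1) in auto)
    with sv show False by simp
  qed
  define u where "u = (\<lambda>m. \<phi> $ m * \<psi> $ m)"
  have u1: "cnj (u m) * u m = 1" if "m < L" for m
  proof -
    have "cnj (u m) * u m = (\<phi> $ m * cnj (\<phi> $ m)) * (\<psi> $ m * cnj (\<psi> $ m))"
      by (simp only: u_def complex_cnj_mult mult_ac)
    then show ?thesis by (simp only: \<phi>1[OF that] \<psi>1[OF that] mult_1)
  qed
  have z1z: "cnj (?z1 $ m) * ?z1 $ m = 1" if "m < L" for m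
  proof -
    have "cnj (?z1 $ m) * ?z1 $ m = (\<phi> $ m * cnj (\<phi> $ m)) * (\<phi> $ sub_mod L m 1 * cnj (\<phi> $ sub_mod L m 1))"
      using that L by (simp add: w\<phi> mult_ac)
    then show ?thesis using that L by (simp add: \<phi>1)
  qed
  \<comment> \<open>As \<open>w\<close> is the conjugate of \<open>\<phi>\<close>, conjugating
    \<open>?z1\<close> gives the successive ratios of \<open>\<phi>\<close>; multiplied by those of
    \<open>\<psi>\<close> they are the ratios of \<open>u\<close>.\<close>
  have uz: "u m * cnj (u (sub_mod L m 1)) = ?z2 $ m * cnj (?z1 $ m)" if "m < L" for m
    using that L by (simp add: u_def w\<phi> mult_ac)
  define c where "c = ?z2 $ 0 * cnj (?z1 $ 0)"
  have "u m = c * u (sub_mod L m 1)" if m: "m < L" for m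
  proof -
    have "?z2 $ m * cnj (?z1 $ m) = ?z2 $ m * cnj (?z1 $ m) * (cnj (?z1 $ 0) * ?z1 $ 0)"
      using z1z[OF L] by simp
    also have "\<dots> = (?z2 $ m * ?z1 $ 0) * cnj (?z1 $ 0) * cnj (?z1 $ m)"
      by (simp only: mult_ac)
    also have "\<dots> = c * (cnj (?z1 $ m) * ?z1 $ m)"
      unfolding ratio[OF m] c_def by (simp only: mult_ac)
    finally have "u m * cnj (u (sub_mod L m 1)) = c"
      by (simp only: z1z[OF m] uz[OF m] mult_1_right)
    moreover have "u m = u m * (cnj (u (sub_mod L m 1)) * u (sub_mod L m 1))"
      using u1[of "sub_mod L m 1"] L by simp
    ultimately show ?thesis by (metis mult.assoc)
  qed
  then have "\<forall>m<L. u m = c * u (sub_mod L m 1)" by blast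
  then show ?thesis unfolding u_def by (rule exI)
qed

text \<open>Starting from \<open>u 0 = 1\<close> the recursion produces powers of \<open>c\<close>;
  its wraparound at index 0 closes the cycle and makes \<open>c\<close> a root of unity.\<close>

lemma phase_step_character:
  fixes u :: "nat \<Rightarrow> complex"
  assumes L: "L > 0" and u0: "u 0 = 1" and step: "\<And>m. m < L \<Longrightarrow> u m = c * u (sub_mod L m 1)"
  shows "c ^ L = 1" "m < L \<Longrightarrow> u m = c ^ m"
proof -
  have pow: "u m = c ^ m" if "m < L" for m
    using that
  proof (induction m)
    case (Suc m)
    then show ?case using step[of "Suc m"] by (simp add: sub_mod_le)
  qed (simp add: u0)
  have "sub_mod L 0 1 = L - 1"
    using L by (simp add: sub_mod_def zmod_minus1 nat_diff_distrib)
  then have "1 = c * c ^ (L - 1)" using step[of 0] L u0 pow[of "L - 1"] by simp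
  then show "c ^ L = 1" using L by (metis power_eq_if not_gr0)
  show "m < L \<Longrightarrow> u m = c ^ m" by (rule pow)
qed

text \<open>Writing \<open>c\<close> as an \<open>L\<close>-th root of unity with index
  \<open>l\<close>, the powers of its conjugate are the entries of \<open>fourier_vec L l\<close>,
  and \<open>c^(j-i)\<close> splits into a row factor and a column factor.\<close>

lemma Omega_character:
  assumes L: "L > 0" and S: "S \<in> carrier_mat L L" and c: "c ^ L = 1"
  shows "S \<odot> circulant (vec L (\<lambda>m. c ^ m)) \<in> Omega L S"
proof -
  have "c \<in> (\<lambda>k. cis (2 * pi * real k / real L)) ` {..<L}"
    using bij_betw_roots_unity[OF L] c by (simp add: bij_betw_def)
  then obtain l where l: "l < L" "c = cis (2 * pi * real l / real L)" by auto
  have cc: "c * cnj c = 1" by (simp add: l cis_cnj cis_mult)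
  have f: "fourier_vec L l $ k = cnj c ^ k" if "k < L" for k
  proof -
    have "fourier_vec L l $ k = exp (of_nat k * (\<i> * complex_of_real (- (2 * pi * real l / real L))))"
      using that by (simp add: fourier_vec_def mult_ac)
    also have "\<dots> = cnj c ^ k"
      unfolding exp_of_nat_mult l cis_cnj by (simp only: cis_conv_exp)
    finally show ?thesis .
  qed
  have "S \<odot> circulant (vec L (\<lambda>m. c ^ m)) =
      diag_of_vec (fourier_vec L l) * S * diag_of_vec (conjugate (fourier_vec L l))"
  proof (rule eq_matI)
    fix i j assume "i < dim_row (diag_of_vec (fourier_vec L l) * S * diag_of_vec (conjugate (fourier_vec L l)))"
      "j < dim_col (diag_of_vec (fourier_vec L l) * S * diag_of_vec (conjugate (fourier_vec L l)))"
    then have ij: "i < L" "j < L" by (auto simp: diag_of_vec_def fourier_vec_def mat_diag_def)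
    \<comment> \<open>Exponents matter only modulo \<open>L\<close>, which absorbs the reduction
      inside \<open>sub_mod\<close>.\<close>
    have mod_pow: "c ^ n = c ^ (n mod L)" for n
      by (metis c mult_div_mod_eq power_add power_mult power_one mult_1)
    have "c ^ sub_mod L j i = c ^ sub_mod L j i * (c ^ i * cnj c ^ i)"
      by (simp add: cc flip: power_mult_distrib)
    also have "\<dots> = c ^ (sub_mod L j i + i) * cnj c ^ i" by (simp add: power_add)
    also have "c ^ (sub_mod L j i + i) = c ^ j"
      using mod_pow[of "sub_mod L j i + i"] sub_mod_add_mod[OF L, of j i] ij by simp
    finally have u: "c ^ sub_mod L j i = c ^ j * cnj c ^ i" .
    have "(diag_of_vec (fourier_vec L l) * S * diag_of_vec (conjugate (fourier_vec L l))) $$ (i, j) =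
        fourier_vec L l $ i * S $$ (i, j) * cnj (fourier_vec L l $ j)"
      using S ij by (simp add: diag_of_vec_def mat_diag_mult_left[of _ L L] mat_diag_mult_right[of _ L L]
          fourier_vec_def)
    then show "(S \<odot> circulant (vec L (\<lambda>m. c ^ m))) $$ (i, j) =
        (diag_of_vec (fourier_vec L l) * S * diag_of_vec (conjugate (fourier_vec L l))) $$ (i, j)"
      using S ij L by (simp add: f index_hadamard index_circulant u)
  qed (use S in \<open>auto simp: diag_of_vec_def fourier_vec_def mat_diag_def\<close>)
  then show ?thesis using l(1) unfolding Omega_def by blast
qed

text \<open>Leading eigenvectors are not unique; \<open>V\<close> stands for any choice of them for
  which the singular value condition holds.\<close>

theorem lemma4:
  fixes L r :: nat
    and \<Sigma> X X' :: "complex mat"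
    and \<phi> \<phi>' :: "nat \<Rightarrow> real"
    and V :: "nat \<Rightarrow> complex mat"
  assumes "\<Sigma> \<in> carrier_mat L L"
    and "hermitian_psd \<Sigma>"
    and "vec_space.rank L \<Sigma> = r"
    and "\<forall>m \<in> {1..<L}. \<phi> m \<in> {0..<2 * pi}"
    and "X = \<Sigma> \<odot> circulant (phase_vec L \<phi>)"
    and "\<forall>i < L. \<forall>j < L. \<Sigma> $$ (i, j) \<noteq> 0"
    and "r = 1 \<or>
      (1 < r \<and> real r < sqrt (real L) \<and>
       (\<forall>i < L. leading_eigenvectors (H_mat L X i i) (r ^ 2) (V i)) \<and>
       0 < second_smallest_singular_value (W_mat L X V))"
    and "\<forall>m \<in> {1..<L}. \<phi>' m \<in> {0..<2 * pi}"
    and "X' = X \<odot> circulant (phase_vec L (\<lambda>m. - \<phi>' m))"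
    and "hermitian_psd X'"
  shows "X' \<in> Omega L \<Sigma>"
proof -
  note S = assms(1,2) and rank = assms(3) and X = assms(5) and X' = assms(9)
  \<comment> \<open>The combined phases carry the original matrix directly to
    \<open>X'\<close>.\<close>
  define u where "u = vec L (\<lambda>m. phase_vec L \<phi> $ m * phase_vec L (\<lambda>m. - \<phi>' m) $ m)"
  have u: "u \<in> carrier_vec L" "\<And>m. m < L \<Longrightarrow> cmod (u $ m) = 1"
    by (simp_all add: u_def norm_mult cmod_phase_vec)
  \<comment> \<open>The rank is positive in both cases and at most \<open>L\<close>.\<close>
  have L: "L > 0"
  proof (rule ccontr)
    assume "\<not> L > 0"
    moreover have "r \<le> L" using vec_space.rank_le_nc[OF S(1)] rank by simp
    ultimately show False using assms(7) by auto
  qed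
  have u0: "u $ 0 = 1" using L by (simp add: u_def phase_vec_0)
  have X'u: "X' = \<Sigma> \<odot> circulant u"
    using S L by (intro eq_matI)
      (auto simp: X X' u_def index_hadamard[of _ L L] index_circulant[of _ L])
  have "\<exists>c. \<forall>m<L. u $ m = c * u $ sub_mod L m 1"
  proof (cases "r = 1")
    case True
    then show ?thesis
      using rank_one_psd_phase_step[OF S _ _ u(1) u0 u(2) _ L] rank assms(6,10) X'u by blast
  next
    case False
    then have "\<exists>c. \<forall>m<L. phase_vec L \<phi> $ m * phase_vec L (\<lambda>m. - \<phi>' m) $ m =
        c * (phase_vec L \<phi> $ sub_mod L m 1 * phase_vec L (\<lambda>m. - \<phi>' m) $ sub_mod L m 1)"
      using assms(7,10) by (intro phase_step_of_singular_value[OF S rank _ refl refl X, of V])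
        (auto simp: X')
    then show ?thesis using L by (simp add: u_def)
  qed
  then obtain c where c: "\<And>m. m < L \<Longrightarrow> u $ m = c * u $ sub_mod L m 1" by blast
  note character = phase_step_character[OF L, of "\<lambda>m. u $ m", OF u0 c]
  have cL: "c ^ L = 1" by (rule character(1))
  have cm: "u $ m = c ^ m" if "m < L" for m by (rule character(2)[OF _ that])
  have "u = vec L (\<lambda>m. c ^ m)" using u(1) cm by (intro eq_vecI) auto
  then show ?thesis using Omega_character[OF L S(1) cL] X'u by simp
qed

end
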